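(* If $f:\Omega\to X$ is a Lipschitz map from an open set $\Omega\subset\mathbb{R}^n$ to a metric space $X$ of topological dimension $\dim X=k$, then $\operatorname{rank}\operatorname{md}(f,x)\leq k$ for almost all $x\in\Omega$.
   Context: Topological (small inductive) dimension $\dim X$ of a metric space: $\dim X$ is an integer $\geq -1$ or $\infty$; $\dim X=-1$ iff $X=\varnothing$; $\dim X\leq j$ if every point of $X$ has arbitrarily small (open) neighborhoods whose boundaries have dimension $\leq j-1$; $\dim X=j$ if $\dim X\leq j$ holds and $\dim X\leq j-1$ does not; $\dim X=\infty$ if $\dim X\leq j$ is false for all integers $j\geq-1$. Metric derivative: a map $f$ from an open set $\Omega\subset\mathbb{R}^n$ to a metric space $(X,d)$ is metrically differentiable at $x\in\Omega$ if there is a seminorm $\operatorname{md}(f,x)(\cdot)$ on $\mathbb{R}^n$ with $$\lim_{y\to x}\frac{d(f(y),f(x))-\operatorname{md}(f,x)(y-x)}{|y-x|}=0 .$$ The seminorm is then unique; Lipschitz maps are metrically differentiable a.e. (Kirchheim). The rank of a seminorm $\sigma$ on $\mathbb{R}^n$ is $n-\dim\{v:\sigma(v)=0\}$. *)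

theory Defs
  imports "HOL-Analysis.Analysis"
begin

text \<open>
  The library relation \<^const>\<open>dimension_le\<close> is the bound \<open>dim X \<le> j\<close> for the small
  inductive dimension; the infinite value of \<open>dim X\<close> is \<open>\<infinity> :: ereal\<close>.
\<close>

definition has_small_inductive_dim :: "'a topology \<Rightarrow> ereal \<Rightarrow> bool" where
  "has_small_inductive_dim X k \<longleftrightarrow>
     (\<exists>j::int. k = ereal (real_of_int j) \<and> X dim_le j \<and> \<not> X dim_le (j - 1)) \<or>
     (k = \<infinity> \<and> (\<forall>j::int. \<not> X dim_le j))"

definition seminorm :: "('a::real_vector \<Rightarrow> real) \<Rightarrow> bool" where
  "seminorm \<sigma> \<longleftrightarrow>
     (\<forall>v. 0 \<le> \<sigma> v) \<and>
     (\<forall>c v. \<sigma> (c *\<^sub>R v) = \<bar>c\<bar> * \<sigma> v) \<and>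
     (\<forall>v w. \<sigma> (v + w) \<le> \<sigma> v + \<sigma> w)"

definition seminorm_rank :: "('a::euclidean_space \<Rightarrow> real) \<Rightarrow> nat" where
  "seminorm_rank \<sigma> = DIM('a) - dim {v. \<sigma> v = 0}"

definition has_metric_derivative ::
    "'b metric \<Rightarrow> 'a::euclidean_space set \<Rightarrow> ('a \<Rightarrow> 'b) \<Rightarrow> 'a \<Rightarrow> ('a \<Rightarrow> real) \<Rightarrow> bool" where
  "has_metric_derivative X \<Omega> f x \<sigma> \<longleftrightarrow>
     seminorm \<sigma> \<and>
     ((\<lambda>y. (mdist X (f y) (f x) - \<sigma> (y - x)) / norm (y - x)) \<longlongrightarrow> 0) (at x within \<Omega>)"

definition metrically_differentiable ::
    "'b metric \<Rightarrow> 'a::euclidean_space set \<Rightarrow> ('a \<Rightarrow> 'b) \<Rightarrow> 'a \<Rightarrow> bool" where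
  "metrically_differentiable X \<Omega> f x \<longleftrightarrow> (\<exists>\<sigma>. has_metric_derivative X \<Omega> f x \<sigma>)"

text \<open>
  The description below denotes the metric derivative only where \<open>f\<close> is metrically differentiable;
  uniqueness at points of an open set is \<open>has_metric_derivative_unique\<close>.
\<close>

definition md ::
    "'b metric \<Rightarrow> 'a::euclidean_space set \<Rightarrow> ('a \<Rightarrow> 'b) \<Rightarrow> 'a \<Rightarrow> 'a \<Rightarrow> real" where
  "md X \<Omega> f x = (THE \<sigma>. has_metric_derivative X \<Omega> f x \<sigma>)"

lemma has_metric_derivative_unique:
  assumes "open \<Omega>" "x \<in> \<Omega>"
    and \<sigma>: "has_metric_derivative X \<Omega> f x \<sigma>" and \<tau>: "has_metric_derivative X \<Omega> f x \<tau>"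
  shows "\<sigma> = \<tau>"
proof
  fix v
  have hom: "\<sigma> (c *\<^sub>R v) = \<bar>c\<bar> * \<sigma> v" "\<tau> (c *\<^sub>R v) = \<bar>c\<bar> * \<tau> v" for c
    using \<sigma> \<tau> by (auto simp: has_metric_derivative_def seminorm_def)
  show "\<sigma> v = \<tau> v"
  proof (cases "v = 0")
    case True
    then show ?thesis using hom[of 0] by simp
  next
    case False
    let ?q = "\<lambda>y. (\<tau> (y - x) - \<sigma> (y - x)) / norm (y - x)"
    have "((\<lambda>y. (mdist X (f y) (f x) - \<sigma> (y - x)) / norm (y - x)
              - (mdist X (f y) (f x) - \<tau> (y - x)) / norm (y - x)) \<longlongrightarrow> 0 - 0) (at x within \<Omega>)"
      using \<sigma> \<tau> by (intro tendsto_diff) (auto simp: has_metric_derivative_def)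
    moreover have "(a - b) / d - (a - c) / d = (c - b) / d" for a b c d :: real
      by (simp flip: diff_divide_distrib)
    ultimately have q: "(?q \<longlongrightarrow> 0) (at x)"
      by (simp only: diff_0_right at_within_open[OF \<open>x \<in> \<Omega>\<close> \<open>open \<Omega>\<close>])
    have "filterlim (\<lambda>t::real. x + t *\<^sub>R v) (at x) (at_right 0)"
      unfolding filterlim_at
    proof
      show "\<forall>\<^sub>F t in at_right (0::real). x + t *\<^sub>R v \<in> UNIV \<and> x + t *\<^sub>R v \<noteq> x"
        using False by (auto simp: eventually_at_filter)
      show "((\<lambda>t. x + t *\<^sub>R v) \<longlongrightarrow> x) (at_right 0)"
        by (rule tendsto_eq_intros refl | simp)+
    qed
    from filterlim_compose[OF q this]
    have "((\<lambda>t. ?q (x + t *\<^sub>R v)) \<longlongrightarrow> 0) (at_right 0)" .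
    moreover have "\<forall>\<^sub>F t in at_right (0::real). ?q (x + t *\<^sub>R v) = (\<tau> v - \<sigma> v) / norm v"
      by (auto simp: eventually_at_filter hom simp flip: right_diff_distrib)
    ultimately have "((\<lambda>t::real. (\<tau> v - \<sigma> v) / norm v) \<longlongrightarrow> 0) (at_right 0)"
      by (rule Lim_transform_eventually)
    then have "(\<tau> v - \<sigma> v) / norm v = 0"
      by (simp add: tendsto_const_iff)
    then show ?thesis using False by simp
  qed
qed

lemma md_eq:
  assumes "open \<Omega>" "x \<in> \<Omega>" "has_metric_derivative X \<Omega> f x \<sigma>"
  shows "md X \<Omega> f x = \<sigma>"
  unfolding md_def using assms has_metric_derivative_unique by (intro the_equality) blast+

end

theory Submission
  imports Defs
begin

text \<open>
  Put \<open>d\<close> for the metric of \<open>X\<close> and choose points \<open>p\<^sub>i\<close> that are dense in \<open>f(\<Omega>)\<close>. The functions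
  \<open>y \<mapsto> d(f(y), p\<^sub>i)\<close> are Lipschitz on \<open>\<Omega>\<close>, extend to Lipschitz functions \<open>F\<^sub>i\<close> on the whole space
  (\<open>mcshane_extension\<close>), and recover the metric, since \<open>d(f(x), f(y)) = sup\<^sub>i |F\<^sub>i(x) - F\<^sub>i(y)|\<close> on \<open>\<Omega>\<close>.
  So the theorem is about a countable family of real Lipschitz functions. Almost everywhere all \<open>F\<^sub>i\<close>
  are differentiable, and the metric derivative of \<open>f\<close> is \<open>v \<mapsto> sup\<^sub>i |DF\<^sub>i(x) v|\<close>.

  Both of these facts come from one estimate, \<open>increment_le_at_approx_upper_semicontinuity\<close>: if the
  increments of \<open>G\<close> in direction \<open>v\<close> are at most the line integrals of a bounded Borel function \<open>u\<close>,
  then at a point \<open>x\<close> where every set \<open>{u > q}\<close> with \<open>q > u(x)\<close> has density zero, the increments of \<open>G\<close>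
  near \<open>x\<close> are at most \<open>t u(x)\<close> plus a small error, uniformly in \<open>G\<close> and in the base point. The reason is
  that among the parallel segments close to a given one, some segment spends hardly any time in
  \<open>{u > q}\<close>. By Lebesgue's density theorem this applies at almost every \<open>x\<close>. With \<open>u\<close> equal to plus or
  minus a partial derivative, it gives Rademacher's theorem (the uniformity in the base point lets one
  walk from \<open>x\<close> to \<open>x + y\<close> along the coordinate directions); with \<open>u = sup\<^sub>i |\<partial>\<^sub>v F\<^sub>i|\<close>, it gives the
  upper bound of the metric derivative. The lower bound only needs the derivatives of finitely many \<open>F\<^sub>i\<close>.

  The kernel of \<open>v \<mapsto> sup\<^sub>i |DF\<^sub>i(x) v|\<close> is the orthogonal complement of the gradients of the \<open>F\<^sub>i\<close> at
  \<open>x\<close>. If the rank exceeds \<open>k\<close>, there are therefore \<open>m = k + 1\<close> indices with independent gradients.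
  Take a small cube \<open>Q\<close> around \<open>x\<close>, spanned by the dual vectors of these gradients. The corresponding
  functions \<open>d(-, p\<^sub>i)\<close> on \<open>f(Q)\<close> separate the images of opposite faces of \<open>Q\<close>. In a compact Hausdorff
  space of small inductive dimension at most \<open>m - 1\<close>, any \<open>m\<close> pairs of disjoint closed sets can be enlarged to
  pairs of disjoint closed sets that cover the space (\<open>dim_le_imp_enlargeable_over\<close>). Pulling such a
  cover of \<open>f(Q)\<close> back to \<open>Q\<close> contradicts Brouwer's fixed point theorem (\<open>cube_opposite_faces_linked\<close>).
\<close>

section \<open>Density points\<close>

definition has_density_zero :: "'a::euclidean_space set \<Rightarrow> 'a \<Rightarrow> bool" where
  "has_density_zero E x \<longleftrightarrow>
     (\<forall>e>0. \<exists>d>0. \<forall>r. 0 < r \<and> r < d \<longrightarrow>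
        emeasure lborel (E \<inter> ball x r) \<le> ennreal e * emeasure lborel (ball x r))"

text \<open>
  Exhaust \<open>E\<close> from inside by a closed set \<open>T\<close> up to small measure. The exceptional points lie in the
  open complement of \<open>T\<close>, so Vitali's theorem covers almost all of them by disjoint balls that miss \<open>T\<close>
  and of which a fixed proportion lies in \<open>E\<close>, hence in the small set \<open>E - T\<close>.
\<close>

lemma negligible_positive_density_outside:
  fixes E :: "'a::euclidean_space set"
  assumes E: "E \<in> sets borel" and c: "c > 0"
  defines "S \<equiv> {x. x \<notin> E \<and> (\<forall>d>0. \<exists>r. 0 < r \<and> r < d \<and>
        emeasure lborel (ball x r) \<le> ennreal c * emeasure lborel (E \<inter> ball x r))}"
  shows "negligible S"
  unfolding negligible_outer_le
proof (intro allI impI)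
  fix e :: real assume "e > 0"
  obtain T where T: "closed T" "T \<subseteq> E" and TE: "emeasure lebesgue (E - T) < ennreal (e / c)"
    by (rule sets_lebesgue_inner_closed[of E "e / c"]) (use E \<open>e > 0\<close> c in auto)
  have TE: "emeasure lborel (E - T) \<le> ennreal (e / c)"
  proof -
    have "E - T \<in> sets lborel" using E T by auto
    then show ?thesis using TE by simp
  qed
  define K where "K = {(x,r). x \<in> S \<and> 0 < r \<and> ball x r \<inter> T = {} \<and>
     emeasure lborel (ball x r) \<le> ennreal c * emeasure lborel (E \<inter> ball x r)}"
  obtain C where C: "countable C" "C \<subseteq> K"
    and pw: "pairwise (\<lambda>i j. disjnt (ball (fst i) (snd i)) (ball (fst j) (snd j))) C"
    and neg: "negligible (S - (\<Union>i \<in> C. ball (fst i) (snd i)))"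
  proof (rule Vitali_covering_theorem_balls[of S K fst snd])
    fix x and d :: real assume x: "x \<in> S" and d: "0 < d"
    have "x \<in> - T" "open (- T)" using x T by (auto simp: S_def)
    then obtain d' where d': "d' > 0" "ball x d' \<subseteq> - T" by (meson open_contains_ball)
    obtain r where r: "0 < r" "r < min d d'"
      "emeasure lborel (ball x r) \<le> ennreal c * emeasure lborel (E \<inter> ball x r)"
      using x d d'(1) unfolding S_def by (elim CollectE conjE allE[of _ "min d d'"]) auto
    have "ball x r \<subseteq> ball x d'" using r by (intro subset_ball) auto
    then have "(x, r) \<in> K" using r x d' by (auto simp: K_def)
    then show "\<exists>i. i \<in> K \<and> x \<in> ball (fst i) (snd i) \<and> snd i < d" using r by force
  qed
  let ?U = "\<Union>i \<in> C. ball (fst i) (snd i)"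
  have disj: "disjoint_family_on (\<lambda>i. ball (fst i) (snd i)) C"
    using pw by (auto simp: disjoint_family_on_def pairwise_def disjnt_def)
  then have disjE: "disjoint_family_on (\<lambda>i. E \<inter> ball (fst i) (snd i)) C"
    unfolding disjoint_family_on_def by blast
  have "emeasure lborel ?U = (\<integral>\<^sup>+i. emeasure lborel (ball (fst i) (snd i)) \<partial>count_space C)"
    by (rule emeasure_UN_countable) (use C disj in auto)
  also have "\<dots> \<le> (\<integral>\<^sup>+i. ennreal c * emeasure lborel (E \<inter> ball (fst i) (snd i)) \<partial>count_space C)"
    using C(2) by (intro nn_integral_mono) (auto simp: K_def)
  also have "\<dots> = ennreal c * (\<integral>\<^sup>+i. emeasure lborel (E \<inter> ball (fst i) (snd i)) \<partial>count_space C)"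
    by (rule nn_integral_cmult) auto
  also have "(\<integral>\<^sup>+i. emeasure lborel (E \<inter> ball (fst i) (snd i)) \<partial>count_space C)
      = emeasure lborel (\<Union>i\<in>C. E \<inter> ball (fst i) (snd i))"
    by (rule emeasure_UN_countable[symmetric]) (use C disjE E in auto)
  also have "\<dots> \<le> emeasure lborel (E - T)"

  proof (rule emeasure_mono)
    show "(\<Union>i\<in>C. E \<inter> ball (fst i) (snd i)) \<subseteq> E - T"
      using C(2) unfolding K_def by fastforce
  qed (use E T in auto)
  also have "ennreal c * \<dots> \<le> ennreal c * ennreal (e / c)"
    by (rule mult_left_mono[OF TE]) simp
  also have "\<dots> = ennreal e" using c \<open>e > 0\<close> by (simp flip: ennreal_mult)
  finally have U: "emeasure lborel ?U \<le> ennreal e" by (simp add: mult_left_mono)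
  have "open ?U" by (intro open_UN ballI open_ball)
  then have Us: "?U \<in> sets lborel" by simp
  then have Uf: "?U \<in> lmeasurable" "measure lebesgue ?U \<le> e"
    using U \<open>e > 0\<close> by (auto simp: fmeasurable_def measure_def intro: le_less_trans enn2real_leI)
  show "\<exists>T. S \<subseteq> T \<and> T \<in> lmeasurable \<and> measure lebesgue T \<le> e"
  proof (intro exI conjI)
    show "S \<subseteq> ?U \<union> (S - ?U)" by auto
    show "?U \<union> (S - ?U) \<in> lmeasurable"
      using Uf neg by (intro fmeasurable.Un) (auto intro: negligible_imp_measurable)
    have "measure lebesgue (?U \<union> (S - ?U)) \<le> measure lebesgue ?U + measure lebesgue (S - ?U)"
      using Uf neg by (intro measure_Un_le) (auto intro: negligible_imp_measurable fmeasurableD)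
    then show "measure lebesgue (?U \<union> (S - ?U)) \<le> e"
      using Uf neg by (simp add: negligible_imp_measure0)
  qed
qed

lemma AE_has_density_zero:
  fixes E :: "'a::euclidean_space set"
  assumes E: "E \<in> sets borel"
  shows "AE x in lebesgue. x \<notin> E \<longrightarrow> has_density_zero E x"
proof -
  define S where "S n = {x. x \<notin> E \<and> (\<forall>d>0. \<exists>r. 0 < r \<and> r < d \<and>
        emeasure lborel (ball x r) \<le> ennreal (real (Suc n)) * emeasure lborel (E \<inter> ball x r))}" for n
  have "negligible (S n)" for n
    unfolding S_def by (rule negligible_positive_density_outside[OF E]) simp
  then have "negligible (\<Union>n. S n)" by (intro negligible_Union_nat)
  then have "(\<Union>n. S n) \<in> null_sets lebesgue" by (simp add: negligible_iff_null_sets)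
  then show ?thesis
  proof (rule AE_I')
    show "{x \<in> space lebesgue. \<not> (x \<notin> E \<longrightarrow> has_density_zero E x)} \<subseteq> (\<Union>n. S n)"
    proof
      fix x assume "x \<in> {x \<in> space lebesgue. \<not> (x \<notin> E \<longrightarrow> has_density_zero E x)}"
      then have nd: "\<not> has_density_zero E x" "x \<notin> E" by auto
      then obtain e where e: "e > 0" and *: "\<And>d. d > 0 \<Longrightarrow> \<exists>r. 0 < r \<and> r < d \<and>
          \<not> emeasure lborel (E \<inter> ball x r) \<le> ennreal e * emeasure lborel (ball x r)"
        unfolding has_density_zero_def by auto
      obtain n where n: "inverse (real (Suc n)) < e" using reals_Archimedean e by blast
      have "emeasure lborel (ball x r) \<le> ennreal (real (Suc n)) * emeasure lborel (E \<inter> ball x r)"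
        if "ennreal e * emeasure lborel (ball x r) < emeasure lborel (E \<inter> ball x r)" for r
      proof -
        have "emeasure lborel (ball x r) = ennreal (real (Suc n) * inverse (real (Suc n))) * emeasure lborel (ball x r)"
          by simp
        also have "\<dots> = ennreal (real (Suc n)) * (ennreal (inverse (real (Suc n))) * emeasure lborel (ball x r))"
          by (subst ennreal_mult) (auto simp: mult.assoc)
        also have "\<dots> \<le> ennreal (real (Suc n)) * (ennreal e * emeasure lborel (ball x r))"
          using n by (intro mult_left_mono mult_right_mono ennreal_leI) auto
        also have "\<dots> \<le> ennreal (real (Suc n)) * emeasure lborel (E \<inter> ball x r)"
          using that by (intro mult_left_mono) auto
        finally show ?thesis .
      qed
      then have "x \<in> S n" using * nd(2) unfolding S_def by (simp add: not_le) blast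
      then show "x \<in> (\<Union>n. S n)" by blast
    qed
  qed
qed

lemma has_density_zero_subset:
  assumes "has_density_zero E x" "D \<subseteq> E" "E \<in> sets borel"
  shows "has_density_zero D x"
proof -
  have "emeasure lborel (D \<inter> ball x r) \<le> emeasure lborel (E \<inter> ball x r)" for r
    using assms by (intro emeasure_mono) auto
  then show ?thesis
    using assms(1) unfolding has_density_zero_def by (meson order_trans)
qed

lemma emeasure_lborel_ball_scale:
  assumes "a \<ge> 0" "r \<ge> 0"
  shows "emeasure lborel (ball (x::'a::euclidean_space) (a * r))
       = ennreal (a ^ DIM('a)) * emeasure lborel (ball (y::'a) r)"
proof -
  have *: "emeasure lborel (ball c s) = ennreal (s ^ DIM('a)) * emeasure lborel (ball (0::'a) 1)"
    if "s \<ge> 0" for c :: 'a and s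
    using emeasure_lebesgue_ball_conv_unit_ball[OF that, of c] by simp
  have "emeasure lborel (ball x (a * r)) = ennreal ((a * r) ^ DIM('a)) * emeasure lborel (ball (0::'a) 1)"
    using assms by (intro *) auto
  also have "\<dots> = ennreal (a ^ DIM('a)) * (ennreal (r ^ DIM('a)) * emeasure lborel (ball (0::'a) 1))"
    using assms by (simp add: power_mult_distrib ennreal_mult mult.assoc)
  also have "ennreal (r ^ DIM('a)) * emeasure lborel (ball (0::'a) 1) = emeasure lborel (ball y r)"
    using *[of r y] assms by simp
  finally show ?thesis .
qed

lemma nn_integral_indicator_translate:
  fixes E :: "'a::euclidean_space set"
  assumes "E \<in> sets borel"
  shows "(\<integral>\<^sup>+z. indicator E (z + c) \<partial>lborel) = emeasure lborel E"
proof -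
  have "(\<integral>\<^sup>+z. indicator E z \<partial>distr lborel borel ((+) c)) = (\<integral>\<^sup>+z. indicator E (c + z) \<partial>lborel)"
    by (rule nn_integral_distr) (use assms in auto)
  then show ?thesis
    using assms by (simp add: lborel_distr_plus add.commute)
qed

text \<open>
  By Tonelli's theorem, the average over \<open>z\<close> of the time that the segment from \<open>z\<close> to \<open>z + Rv\<close> spends in \<open>E\<close>
  is controlled by the measure of \<open>E\<close> in a ball around \<open>x\<close> of radius comparable to \<open>R\<close>. So some \<open>z\<close>
  does at least as well as the average.
\<close>

lemma segment_avoiding_density_zero_set:
  fixes E :: "'a::euclidean_space set"
  assumes E: "E \<in> sets borel" and x: "has_density_zero E x"
    and C: "C \<ge> 0" and \<eta>: "\<eta> > 0" and \<kappa>: "\<kappa> > 0"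
  obtains \<delta> where "\<delta> > 0"
    "\<And>R p. 0 < R \<Longrightarrow> R < \<delta> \<Longrightarrow> dist x p \<le> C * R \<Longrightarrow>
       \<exists>z \<in> ball p (\<eta> * R). emeasure lborel {r \<in> {0..R}. z + r *\<^sub>R v \<in> E} \<le> ennreal (\<kappa> * R)"
proof -
  note [measurable] = E borel_open[OF open_ball]
  \<comment> \<open>All the segments that occur stay in the ball of radius \<open>A * R\<close> around \<open>x\<close>. Its volume is
      \<open>(A / \<eta>) ^ DIM('a)\<close> times that of \<open>ball p (\<eta> * R)\<close>, which explains the choice of \<open>e\<close>.\<close>
  define A where "A = C + \<eta> + norm v"
  have A: "A > 0" using C \<eta> by (simp add: A_def add_nonneg_pos add_pos_nonneg)
  define e where "e = \<kappa> / (2 * (A / \<eta>) ^ DIM('a))"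
  have e: "e > 0" using A \<eta> \<kappa> by (simp add: e_def)
  obtain d where d: "d > 0" "\<And>r. 0 < r \<Longrightarrow> r < d \<Longrightarrow>
      emeasure lborel (E \<inter> ball x r) \<le> ennreal e * emeasure lborel (ball x r)"
    using x e unfolding has_density_zero_def by blast
  show ?thesis
  proof (rule that[of "d / A"])
    show "d / A > 0" using d A by simp
    fix R p assume R: "0 < R" "R < d / A" and p: "dist x p \<le> C * R"
    let ?B = "ball p (\<eta> * R)" and ?S = "\<lambda>z. {r \<in> {0..R}. z + r *\<^sub>R v \<in> E}"
    show "\<exists>z \<in> ?B. emeasure lborel (?S z) \<le> ennreal (\<kappa> * R)"
    proof (rule ccontr)
      assume "\<not> ?thesis"
      then have big: "ennreal (\<kappa> * R) \<le> emeasure lborel (?S z)" if "z \<in> ?B" for z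
        using that by (meson nle_le)
      let ?f = "\<lambda>z r. indicator ?B z * (indicator {0..R} r * indicator E (z + r *\<^sub>R v)) :: ennreal"
      have AR: "0 < A * R" "A * R < d" using R A by (auto simp: field_simps)
      have S: "(\<integral>\<^sup>+r. indicator {0..R} r * indicator E (z + r *\<^sub>R v) \<partial>lborel) = emeasure lborel (?S z)" for z
      proof -
        have "?S z \<in> sets lborel" by measurable
        then have "emeasure lborel (?S z) = (\<integral>\<^sup>+r. indicator (?S z) r \<partial>lborel)" by simp
        also have "\<dots> = (\<integral>\<^sup>+r. indicator {0..R} r * indicator E (z + r *\<^sub>R v) \<partial>lborel)"
          by (intro nn_integral_cong) (auto simp: indicator_def)
        finally show ?thesis ..
      qed
      have "ennreal (\<kappa> * R) * emeasure lborel ?B = (\<integral>\<^sup>+z. ennreal (\<kappa> * R) * indicator ?B z \<partial>lborel)"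
        by (simp add: nn_integral_cmult_indicator)
      also have "\<dots> \<le> (\<integral>\<^sup>+z. indicator ?B z * emeasure lborel (?S z) \<partial>lborel)"
        using big by (intro nn_integral_mono) (auto simp: indicator_def)
      also have "\<dots> = (\<integral>\<^sup>+z. \<integral>\<^sup>+r. ?f z r \<partial>lborel \<partial>lborel)"
        by (intro nn_integral_cong, subst nn_integral_cmult) (auto simp: S)
      also have "\<dots> = (\<integral>\<^sup>+r. \<integral>\<^sup>+z. ?f z r \<partial>lborel \<partial>lborel)"
        by (rule lborel_pair.Fubini') measurable
      also have "\<dots> \<le> (\<integral>\<^sup>+r. indicator {0..R} r * emeasure lborel (E \<inter> ball x (A * R)) \<partial>lborel)"
      proof (rule nn_integral_mono)
        fix r
        have "(\<integral>\<^sup>+z. ?f z r \<partial>lborel) \<le> (\<integral>\<^sup>+z. indicator {0..R} r * indicator (E \<inter> ball x (A * R)) (z + r *\<^sub>R v) \<partial>lborel)"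
        proof (rule nn_integral_mono)
          fix z
          have "dist x (z + r *\<^sub>R v) < A * R" if "z \<in> ?B" "r \<in> {0..R}"
          proof -
            have "dist x (z + r *\<^sub>R v) \<le> dist x p + dist p z + dist z (z + r *\<^sub>R v)"
              by metric
            also have "\<dots> < C * R + \<eta> * R + R * norm v"
              using p that by (intro add_less_le_mono add_le_less_mono) (auto simp: dist_norm intro: mult_right_mono)
            finally show ?thesis by (simp add: A_def algebra_simps)
          qed
          then show "?f z r \<le> indicator {0..R} r * indicator (E \<inter> ball x (A * R)) (z + r *\<^sub>R v)"
            by (auto simp: indicator_def)
        qed
        also have "\<dots> = indicator {0..R} r * (\<integral>\<^sup>+z. indicator (E \<inter> ball x (A * R)) (z + r *\<^sub>R v) \<partial>lborel)"
          by (rule nn_integral_cmult) measurable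
        also have "\<dots> = indicator {0..R} r * emeasure lborel (E \<inter> ball x (A * R))"
          by (subst nn_integral_indicator_translate) auto
        finally show "(\<integral>\<^sup>+z. ?f z r \<partial>lborel) \<le> indicator {0..R} r * emeasure lborel (E \<inter> ball x (A * R))" .
      qed
      also have "\<dots> = ennreal R * emeasure lborel (E \<inter> ball x (A * R))"
        using R by (subst nn_integral_multc) auto
      also have "\<dots> \<le> ennreal R * (ennreal e * emeasure lborel (ball x (A * R)))"
        by (intro mult_left_mono d AR) auto
      also have "emeasure lborel (ball x (A * R)) = ennreal ((A / \<eta>) ^ DIM('a)) * emeasure lborel ?B"
        using emeasure_lborel_ball_scale[of "A / \<eta>" "\<eta> * R" x p] A \<eta> R by simp
      also have "ennreal R * (ennreal e * \<dots>) = ennreal (R * e * (A / \<eta>) ^ DIM('a)) * emeasure lborel ?B"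
        using R e A \<eta> by (simp add: ennreal_mult mult.assoc)
      also have "R * e * (A / \<eta>) ^ DIM('a) = \<kappa> * R / 2"
        using A \<eta> by (simp add: e_def)
      finally have "ennreal (\<kappa> * R) * emeasure lborel ?B \<le> ennreal (\<kappa> * R / 2) * emeasure lborel ?B" .
      moreover obtain b where b: "emeasure lborel ?B = ennreal b" "b > 0"
      proof (rule that)
        show "emeasure lborel ?B = ennreal (measure lborel ?B)"
          using emeasure_lborel_ball_finite[of p "\<eta> * R"] by (intro emeasure_eq_ennreal_measure) auto
        show "measure lborel ?B > 0" using content_ball_pos[of "\<eta> * R" p] R \<eta> by simp
      qed
      ultimately have "\<kappa> * R * b \<le> \<kappa> * R / 2 * b"
        using R \<kappa> by (simp flip: ennreal_mult add: b)
      then show False using R \<kappa> b by simp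
    qed
  qed
qed

text \<open>
  This is upper semicontinuity for the density topology. It is the half of approximate continuity
  that suits one-sided estimates of increments.
\<close>

definition approx_upper_semicontinuous_at :: "('a::euclidean_space \<Rightarrow> real) \<Rightarrow> 'a \<Rightarrow> bool" where
  "approx_upper_semicontinuous_at u x \<longleftrightarrow> (\<forall>q > u x. has_density_zero {y. q < u y} x)"

lemma AE_approx_upper_semicontinuous:
  fixes u :: "'a::euclidean_space \<Rightarrow> real"
  assumes [measurable]: "u \<in> borel_measurable borel"
  shows "AE x in lebesgue. approx_upper_semicontinuous_at u x"
proof -
  have m: "{y. q < u y} \<in> sets borel" for q by measurable
  have "AE x in lebesgue. \<forall>q\<in>\<rat>. x \<notin> {y. q < u y} \<longrightarrow> has_density_zero {y. q < u y} x"
    using AE_has_density_zero[OF m] countable_rat by (subst AE_ball_countable) auto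
  then show ?thesis
  proof (rule AE_mp, intro AE_I2 impI)
    fix x assume *: "\<forall>q\<in>\<rat>. x \<notin> {y. q < u y} \<longrightarrow> has_density_zero {y. q < u y} x"
    show "approx_upper_semicontinuous_at u x"
      unfolding approx_upper_semicontinuous_at_def
    proof (intro allI impI)
      fix q assume "u x < q"
      then obtain q' where q': "q' \<in> \<rat>" "u x < q'" "q' < q" using Rats_dense_in_real by blast
      then have "has_density_zero {y. q' < u y} x" using * by auto
      then show "has_density_zero {y. q < u y} x"
        by (rule has_density_zero_subset) (use q' m in auto)
    qed
  qed
qed

lemma bounded_borel_integrable_along_line:
  fixes u :: "'a::euclidean_space \<Rightarrow> real"
  assumes [measurable]: "u \<in> borel_measurable borel" and M: "\<And>y. \<bar>u y\<bar> \<le> M"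
  shows "(\<lambda>r. u (z + r *\<^sub>R v)) integrable_on {a..b}"
  by (rule measurable_bounded_by_integrable_imp_integrable_real[where g = "\<lambda>_. M"])
     (use M in \<open>auto intro!: measurable_completion measurable_restrict_space1\<close>)

text \<open>
  Replace the segment from \<open>p\<close> by a nearby parallel one that hardly meets \<open>{u > u x + \<epsilon> / 3}\<close>; the
  Lipschitz bound pays for the displacement. The error is measured against the scale \<open>R\<close> and not against \<open>t\<close>,
  because later \<open>t\<close> is a single coordinate of a vector of norm \<open>R\<close>. The bound \<open>\<delta>\<close> does not depend on \<open>G\<close>,
  so it serves a whole family of functions at once.
\<close>

lemma increment_le_at_approx_upper_semicontinuity:
  fixes u :: "'a::euclidean_space \<Rightarrow> real"
  assumes u[measurable]: "u \<in> borel_measurable borel" and M: "\<And>y. \<bar>u y\<bar> \<le> M"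
    and x: "approx_upper_semicontinuous_at u x" and \<epsilon>: "\<epsilon> > 0" and C: "C \<ge> 0" and L: "L \<ge> 0"
  obtains \<delta> where "\<delta> > 0"
    "\<And>G p R t. L-lipschitz_on UNIV G \<Longrightarrow>
      (\<And>z t. 0 \<le> t \<Longrightarrow> G (z + t *\<^sub>R v) - G z \<le> integral {0..t} (\<lambda>r. u (z + r *\<^sub>R v))) \<Longrightarrow>
      0 < R \<Longrightarrow> R < \<delta> \<Longrightarrow> dist x p \<le> C * R \<Longrightarrow> 0 \<le> t \<Longrightarrow> t \<le> R \<Longrightarrow>
      G (p + t *\<^sub>R v) - G p \<le> t * u x + \<epsilon> * R"
proof -
  define q where "q = u x + \<epsilon> / 3"
  define E where "E = {y. q < u y}"
  have E[measurable]: "E \<in> sets borel" unfolding E_def by measurable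
  have dz: "has_density_zero E x"
    using x \<epsilon> unfolding approx_upper_semicontinuous_at_def E_def q_def by simp
  define K where "K = M + \<bar>q\<bar> + 1"
  have K: "K > 0" using M[of x] by (simp add: K_def)
  \<comment> \<open>The error \<open>\<epsilon> * R\<close> is split into thirds: \<open>q\<close> instead of \<open>u x\<close>, the time spent in \<open>E\<close> (at most
      \<open>\<epsilon> / (3 * K) * R\<close>, at cost \<open>K\<close>), and the displacement of both endpoints (by at most \<open>\<epsilon> / (6 * (L + 1)) * R\<close>).\<close>
  have uK: "u y \<le> q + K * indicator E y" for y
    using M[of y] by (auto simp: indicator_def E_def K_def)
  obtain \<delta> where \<delta>: "\<delta> > 0" "\<And>R p. 0 < R \<Longrightarrow> R < \<delta> \<Longrightarrow> dist x p \<le> C * R \<Longrightarrow>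
       \<exists>z \<in> ball p (\<epsilon> / (6 * (L + 1)) * R). emeasure lborel {r \<in> {0..R}. z + r *\<^sub>R v \<in> E} \<le> ennreal (\<epsilon> / (3 * K) * R)"
    by (rule segment_avoiding_density_zero_set[OF E dz C, of "\<epsilon> / (6 * (L + 1))" "\<epsilon> / (3 * K)" v])
       (use \<epsilon> K L in auto)
  show ?thesis
  proof (rule that[OF \<delta>(1)])
    fix G :: "'a \<Rightarrow> real" and p R t
    assume G: "L-lipschitz_on UNIV G"
      and Gu: "\<And>z t. 0 \<le> t \<Longrightarrow> G (z + t *\<^sub>R v) - G z \<le> integral {0..t} (\<lambda>r. u (z + r *\<^sub>R v))"
      and R: "0 < R" "R < \<delta>" and p: "dist x p \<le> C * R" and t: "0 \<le> t" "t \<le> R"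
    obtain z where z: "z \<in> ball p (\<epsilon> / (6 * (L + 1)) * R)"
      and zE: "emeasure lborel {r \<in> {0..R}. z + r *\<^sub>R v \<in> E} \<le> ennreal (\<epsilon> / (3 * K) * R)"
      using \<delta>(2)[OF R p] by blast
    let ?S = "{r. z + r *\<^sub>R v \<in> E}"
    have S[measurable]: "?S \<in> sets borel" by measurable
    have meas: "measure lebesgue (?S \<inter> {0..t}) \<le> \<epsilon> / (3 * K) * R"
    proof -
      have "emeasure lborel (?S \<inter> {0..t}) \<le> emeasure lborel {r \<in> {0..R}. z + r *\<^sub>R v \<in> E}"
        using t by (intro emeasure_mono) auto
      then have "emeasure lborel (?S \<inter> {0..t}) \<le> ennreal (\<epsilon> / (3 * K) * R)" using zE by simp
      then have "measure lborel (?S \<inter> {0..t}) \<le> \<epsilon> / (3 * K) * R"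
        unfolding measure_def by (rule enn2real_leI[rotated]) (use \<epsilon> K R in auto)
      then show ?thesis by simp
    qed
    have Sm: "?S \<inter> {0..t} \<in> lmeasurable"
      by (metis S bounded_Int bounded_closed_interval bounded_set_imp_lmeasurable inf_commute lmeasurable_interval(1) sets.Int sets_completionI_sets sets_lborel atLeastAtMost_borel)
    have ind: "(indicat_real ?S has_integral measure lebesgue (?S \<inter> {0..t})) {0..t}"
      using Sm integrable_on_indicator integral_indicator by (metis has_integral_integral)
    have int: "(\<lambda>r. u (z + r *\<^sub>R v)) integrable_on {0..t}"
      by (rule bounded_borel_integrable_along_line[OF u M])
    have bound: "((\<lambda>r. q + K * indicator ?S r) has_integral (t * q + K * measure lebesgue (?S \<inter> {0..t}))) {0..t}"
      using has_integral_add[OF has_integral_const_real[of q 0 t] has_integral_mult_right[OF ind, of K]] t by simp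
    have "G (z + t *\<^sub>R v) - G z \<le> integral {0..t} (\<lambda>r. u (z + r *\<^sub>R v))"
      using Gu t by blast
    also have "\<dots> \<le> t * q + K * measure lebesgue (?S \<inter> {0..t})"
      using uK by (intro has_integral_le[OF integrable_integral[OF int] bound]) (simp add: indicator_def)
    also have "\<dots> \<le> t * q + K * (\<epsilon> / (3 * K) * R)"
      using meas K by (intro add_left_mono mult_left_mono) auto
    also have "\<dots> \<le> t * u x + \<epsilon> * R * (2/3)"
      using K t \<epsilon> mult_right_mono[OF t(2), of "\<epsilon> / 3"] by (simp add: q_def algebra_simps)
    finally have 1: "G (z + t *\<^sub>R v) - G z \<le> t * u x + \<epsilon> * R * (2/3)" .
    have "L * dist p z \<le> L * (\<epsilon> / (6 * (L + 1)) * R)" using z L by (intro mult_left_mono) auto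
    also have "\<dots> \<le> \<epsilon> / 6 * R"
      using L \<epsilon> R by (simp add: field_simps)
    finally have "L * dist p z \<le> \<epsilon> * R / 6" by simp
    moreover have "\<bar>G p - G z\<bar> \<le> L * dist p z" "\<bar>G (p + t *\<^sub>R v) - G (z + t *\<^sub>R v)\<bar> \<le> L * dist p z"
      using lipschitz_onD[OF G, of p z] lipschitz_onD[OF G, of "p + t *\<^sub>R v" "z + t *\<^sub>R v"]
      by (simp_all add: dist_real_def)
    ultimately show "G (p + t *\<^sub>R v) - G p \<le> t * u x + \<epsilon> * R"
      using 1 by linarith
  qed
qed

section \<open>Lipschitz functions on the line and Rademacher's theorem\<close>

text \<open>
  Adding a linear function turns \<open>g\<close> into an increasing bi-Lipschitz homeomorphism \<open>G\<close> of the line. The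
  measure \<open>A \<mapsto> |G(A)|\<close> is absolutely continuous, since Lipschitz maps preserve null sets, so it has a
  density by the Radon-Nikodym theorem; subtracting the slope of the linear function gives the integrand for \<open>g\<close>.
\<close>

lemma lipschitz_real_indefinite_integral:
  fixes g :: "real \<Rightarrow> real"
  assumes g: "L-lipschitz_on UNIV g"
  obtains f where "\<And>a b. a \<le> b \<Longrightarrow> (f has_integral (g b - g a)) {a..b}"
proof -
  have L: "L \<ge> 0" using g lipschitz_on_nonneg by blast
  define G where "G x = g x + (L + 1) * x" for x
  have Lip: "\<bar>g x - g y\<bar> \<le> L * \<bar>x - y\<bar>" for x y
    using lipschitz_onD[OF g, of x y] by (simp add: dist_real_def)
  have Ginc: "y - x \<le> G y - G x" if "x \<le> y" for x y
    using Lip[of y x] that by (simp add: G_def algebra_simps abs_le_iff)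
  have GLip: "\<bar>G x - G y\<bar> \<le> (2*L+1) * \<bar>x - y\<bar>" for x y
  proof -
    have "G x - G y = (g x - g y) + (L+1) * (x - y)" by (simp add: G_def algebra_simps)
    then have "\<bar>G x - G y\<bar> \<le> \<bar>g x - g y\<bar> + \<bar>(L+1) * (x - y)\<bar>" by linarith
    also have "\<dots> \<le> L * \<bar>x - y\<bar> + (L+1) * \<bar>x - y\<bar>" using Lip[of x y] L by (simp add: abs_mult)
    finally show ?thesis by (simp add: algebra_simps)
  qed
  have contG: "continuous_on UNIV G"
    unfolding G_def using lipschitz_on_continuous_on[OF g] by (intro continuous_intros)
  have injG: "G x < G y" if "x < y" for x y using Ginc[of x y] that by linarith
  have mono: "G x \<le> G y \<longleftrightarrow> x \<le> y" for x y using injG by (metis less_eq_real_def linorder_not_less)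
  have surj: "\<exists>x. G x = y" for y
  proof -
    have "\<exists>x\<ge>- \<bar>y - G 0\<bar>. x \<le> \<bar>y - G 0\<bar> \<and> G x = y"
      using Ginc[of 0 "\<bar>y - G 0\<bar>"] Ginc[of "- \<bar>y - G 0\<bar>" 0]
      by (intro IVT') (auto intro: continuous_on_subset[OF contG])
    then show ?thesis by blast
  qed
  define H where "H = inv G"
  have inj: "inj G" using injG by (metis injI linorder_neqE_linordered_idom order_less_irrefl)
  have HG: "H (G x) = x" for x by (simp add: H_def inj)
  have GH: "G (H y) = y" for y using surj by (simp add: H_def f_inv_into_f rangeI) (metis surj_def surj_f_inv_f)
  have HLip: "\<bar>H x - H y\<bar> \<le> \<bar>x - y\<bar>" for x y
  proof -
    have "\<bar>H x - H y\<bar> \<le> \<bar>G (H x) - G (H y)\<bar>"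
      using Ginc[of "H x" "H y"] Ginc[of "H y" "H x"] by linarith
    then show ?thesis by (simp add: GH)
  qed
  have "1-lipschitz_on UNIV H" by (rule lipschitz_onI) (auto simp: dist_real_def HLip)
  then have contH: "continuous_on UNIV H" by (rule lipschitz_on_continuous_on)
  then have Hm[measurable]: "H \<in> borel_measurable borel" by (rule borel_measurable_continuous_onI)
  have vimage: "H -` A = G ` A" for A
  proof (intro equalityI subsetI)
    fix y assume "y \<in> H -` A"
    then show "y \<in> G ` A" using GH[of y] by (metis imageI vimageE)
  qed (auto simp: HG)
  \<comment> \<open>The push-forward of Lebesgue measure along \<open>H\<close> is \<open>A \<mapsto> |G(A)|\<close>.\<close>
  let ?\<nu> = "distr lborel borel H"
  have "absolutely_continuous lborel ?\<nu>"
    unfolding absolutely_continuous_def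
  proof
    fix A :: "real set" assume A: "A \<in> null_sets lborel"
    then have As: "A \<in> sets borel" by auto
    have "negligible A" using A by (simp add: negligible_iff_null_sets null_sets_completionI)
    then have "negligible (G ` A)"
      by (rule negligible_locally_Lipschitz_image[rotated])
         (auto intro!: exI[of _ UNIV] exI[of _ "2*L+1"] simp: GLip)
    then have "H -` A \<in> null_sets lborel"
      using measurable_sets[OF Hm As] by (simp add: vimage negligible_iff_null_sets null_sets_def)
    then show "A \<in> null_sets ?\<nu>" using As by (auto simp: null_sets_def emeasure_distr)
  qed
  then obtain f where f: "f \<in> borel_measurable lborel" "density lborel f = ?\<nu>"
    using sigma_finite_measure.Radon_Nikodym[OF sigma_finite_lborel, of ?\<nu>] by auto
  note [measurable] = f(1)[simplified]
  have em: "(\<integral>\<^sup>+x. f x * indicator {a..b} x \<partial>lborel) = ennreal (G b - G a)" if "a \<le> b" for a b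
  proof -
    have "G ` {a..b} = {G a..G b}"
    proof (intro equalityI subsetI)
      fix y assume "y \<in> {G a..G b}"
      then have "H y \<in> {a..b}" using mono GH by (metis atLeastAtMost_iff)
      then show "y \<in> G ` {a..b}" using GH by (metis imageI)
    qed (auto simp: mono)
    then have "emeasure ?\<nu> {a..b} = ennreal (G b - G a)"
      using that mono[of a b] by (simp add: emeasure_distr vimage)
    then show ?thesis using f by (metis emeasure_density lborelD sets_lborel atLeastAtMost_borel)
  qed
  have fin: "AE x in lborel. f x \<noteq> \<infinity>"
  proof -
    have "AE x in lborel. \<forall>n::nat. f x * indicator {-real n..real n} x \<noteq> \<infinity>"
      unfolding AE_all_countable
    proof
      fix n :: nat
      show "AE x in lborel. f x * indicator {-real n..real n} x \<noteq> \<infinity>"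
        using em[of "-real n" "real n"] by (intro nn_integral_PInf_AE) auto
    qed
    then show ?thesis
    proof (rule AE_mp, intro AE_I2 impI)
      fix x assume *: "\<forall>n::nat. f x * indicator {-real n..real n} x \<noteq> \<infinity>"
      obtain n where "\<bar>x\<bar> \<le> real n" using real_arch_simple by blast
      then show "f x \<noteq> \<infinity>" using *[rule_format, of n] by (auto simp: indicator_def abs_le_iff split: if_splits)
    qed
  qed
  define h where "h x = enn2real (f x)" for x
  have hint: "(h has_integral (G b - G a)) {a..b}" if "a \<le> b" for a b
  proof -
    have "((\<lambda>x. h x * indicator {a..b} x) has_integral (G b - G a)) UNIV"
    proof (rule nn_integral_has_integral)
      show "(\<lambda>x. h x * indicator {a..b} x) \<in> borel_measurable borel" unfolding h_def by measurable
      have "(\<integral>\<^sup>+x. ennreal (h x * indicator {a..b} x) \<partial>lborel) = (\<integral>\<^sup>+x. f x * indicator {a..b} x \<partial>lborel)"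
        by (rule nn_integral_cong_AE, rule AE_mp[OF fin], rule AE_I2)
           (auto simp: h_def indicator_def top.not_eq_extremum)
      then show "(\<integral>\<^sup>+x. ennreal (h x * indicator {a..b} x) \<partial>lborel) = ennreal (G b - G a)"
        using em[OF that] by simp
    qed (use that mono in \<open>auto simp: h_def\<close>)
    then show ?thesis
      by (subst has_integral_restrict_UNIV[symmetric]) (erule has_integral_eq[rotated], simp add: indicator_def)
  qed
  show ?thesis
  proof
    fix a b :: real assume "a \<le> b"
    have "((\<lambda>x. h x - (L+1)) has_integral ((G b - G a) - (b - a) *\<^sub>R (L+1))) {a..b}"
      by (intro has_integral_diff hint \<open>a \<le> b\<close>) (use has_integral_const_real[of "L+1" a b] \<open>a \<le> b\<close> in simp)
    then show "((\<lambda>x. h x - (L+1)) has_integral (g b - g a)) {a..b}"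
      by (simp add: G_def algebra_simps)
  qed
qed

lemma lipschitz_real_AE_right_derivative:
  fixes g :: "real \<Rightarrow> real"
  assumes g: "L-lipschitz_on UNIV g"
  obtains f N where "\<And>a b. a \<le> b \<Longrightarrow> (f has_integral (g b - g a)) {a..b}" "negligible N"
    "\<And>x. x \<notin> N \<Longrightarrow> (\<lambda>k. real (Suc k) * (g (x + 1 / real (Suc k)) - g x)) \<longlonglongrightarrow> f x"
proof -
  obtain f where f: "\<And>a b. a \<le> b \<Longrightarrow> (f has_integral (g b - g a)) {a..b}"
    using lipschitz_real_indefinite_integral[OF g] by blast
  have int: "f integrable_on cbox a b" for a b :: real
    using f[of a b] by (cases "a \<le> b") (auto simp: integrable_on_def)
  obtain N where N: "negligible N" and lim:
    "\<And>x e. \<lbrakk>x \<notin> N; 0 < e\<rbrakk> \<Longrightarrow> \<exists>d>0. \<forall>h. 0 < h \<and> h < d \<longrightarrow>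
        norm (integral (cbox x (x + h *\<^sub>R One)) f /\<^sub>R h ^ DIM(real) - f x) < e"
    by (rule integrable_ccontinuous_explicit[of f]) (use int in auto)
  have "(\<lambda>k. real (Suc k) * (g (x + 1 / real (Suc k)) - g x)) \<longlonglongrightarrow> f x" if x: "x \<notin> N" for x
  proof (rule metric_LIMSEQ_I)
    fix e :: real assume "e > 0"
    then obtain d where d: "d > 0" "\<And>h. 0 < h \<and> h < d \<Longrightarrow>
        norm (integral (cbox x (x + h *\<^sub>R One)) f /\<^sub>R h ^ DIM(real) - f x) < e"
      using lim[OF x \<open>e > 0\<close>] by auto
    obtain n where n: "inverse (real (Suc n)) < d" using reals_Archimedean d by blast
    show "\<exists>no. \<forall>k\<ge>no. dist (real (Suc k) * (g (x + 1 / real (Suc k)) - g x)) (f x) < e"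
    proof (intro exI allI impI)
      fix k assume "k \<ge> n"
      define h where "h = 1 / real (Suc k)"
      have "h \<le> inverse (real (Suc n))" using \<open>k \<ge> n\<close> by (simp add: h_def field_simps)
      then have h: "0 < h" "h < d" using n by (auto simp: h_def)
      have "integral (cbox x (x + h)) f = g (x + h) - g x"
        using f[of x "x+h"] h by (simp add: integral_unique)
      moreover have "real (Suc k) = inverse h" "1 / real (Suc k) = h" by (simp_all add: h_def)
      ultimately show "dist (real (Suc k) * (g (x + 1 / real (Suc k)) - g x)) (f x) < e"
        using d(2)[of h] h by (simp only: dist_norm) simp
    qed
  qed
  then show ?thesis using that f N by blast
qed

text \<open>
  The directional derivative along the steps \<open>1 / (k + 1)\<close>, defined at every point so that it is a
  Borel function. At points without a limit the value of \<^const>\<open>lim\<close> is arbitrary; truncating at the Lipschitz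
  bound keeps the function bounded there, and changes nothing where the limit exists and \<open>F\<close> is \<open>L\<close>-Lipschitz.
\<close>

definition forward_derivative :: "real \<Rightarrow> ('a::euclidean_space \<Rightarrow> real) \<Rightarrow> 'a \<Rightarrow> 'a \<Rightarrow> real" where
  "forward_derivative L F v x = max (- (L * norm v)) (min (L * norm v)
     (lim (\<lambda>k. real (Suc k) * (F (x + (1 / real (Suc k)) *\<^sub>R v) - F x))))"

lemma abs_forward_derivative_le: "L \<ge> 0 \<Longrightarrow> \<bar>forward_derivative L F v x\<bar> \<le> L * norm v"
  by (auto simp: forward_derivative_def abs_le_iff)

lemma borel_measurable_forward_derivative:
  assumes "L-lipschitz_on UNIV F"
  shows "forward_derivative L F v \<in> borel_measurable borel"
proof -
  have [measurable]: "F \<in> borel_measurable borel"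
    using lipschitz_on_continuous_on[OF assms] by (rule borel_measurable_continuous_onI)
  show ?thesis unfolding forward_derivative_def by measurable
qed

lemma forward_derivative_eq:
  assumes F: "L-lipschitz_on UNIV F"
    and lim: "(\<lambda>k. real (Suc k) * (F (x + (1 / real (Suc k)) *\<^sub>R v) - F x)) \<longlonglongrightarrow> l"
  shows "forward_derivative L F v x = l"
proof -
  have "\<bar>real (Suc k) * (F (x + (1 / real (Suc k)) *\<^sub>R v) - F x)\<bar> \<le> L * norm v" for k
  proof -
    have "\<bar>F (x + (1 / real (Suc k)) *\<^sub>R v) - F x\<bar> \<le> L * (norm v / real (Suc k))"
      using lipschitz_onD[OF F, of "x + (1 / real (Suc k)) *\<^sub>R v" x] by (simp add: dist_norm)
    then have "real (Suc k) * \<bar>F (x + (1 / real (Suc k)) *\<^sub>R v) - F x\<bar> \<le> real (Suc k) * (L * (norm v / real (Suc k)))"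
      by (intro mult_left_mono) auto
    then show ?thesis by (simp add: abs_mult del: of_nat_Suc)
  qed
  then have "\<bar>l\<bar> \<le> L * norm v"
    by (intro LIMSEQ_le_const2[OF tendsto_rabs[OF lim]]) blast
  then show ?thesis
    using limI[OF lim] by (simp add: forward_derivative_def abs_le_iff)
qed

lemma forward_derivative_has_integral:
  assumes F: "L-lipschitz_on UNIV F" and t: "0 \<le> t"
  shows "((\<lambda>r. forward_derivative L F v (z + r *\<^sub>R v)) has_integral (F (z + t *\<^sub>R v) - F z)) {0..t}"
proof -
  have lip: "(L * norm v)-lipschitz_on UNIV (\<lambda>r. F (z + r *\<^sub>R v))"
  proof (rule lipschitz_onI)
    fix r s :: real
    have "dist (F (z + r *\<^sub>R v)) (F (z + s *\<^sub>R v)) \<le> L * dist (z + r *\<^sub>R v) (z + s *\<^sub>R v)"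
      using lipschitz_onD[OF F] by blast
    then show "dist (F (z + r *\<^sub>R v)) (F (z + s *\<^sub>R v)) \<le> L * norm v * dist r s"
      by (simp add: dist_norm mult_ac flip: scaleR_left_diff_distrib)
  qed (use lipschitz_on_nonneg[OF F] in simp)
  obtain f N where f: "\<And>a b. a \<le> b \<Longrightarrow> (f has_integral (F (z + b *\<^sub>R v) - F (z + a *\<^sub>R v))) {a..b}"
    and N: "negligible N" and lim: "\<And>r. r \<notin> N \<Longrightarrow>
      (\<lambda>k. real (Suc k) * (F (z + (r + 1 / real (Suc k)) *\<^sub>R v) - F (z + r *\<^sub>R v))) \<longlonglongrightarrow> f r"
    by (rule lipschitz_real_AE_right_derivative[OF lip]) (rule that; assumption)
  have "forward_derivative L F v (z + r *\<^sub>R v) = f r" if "r \<notin> N" for r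
    using lim[OF that] by (intro forward_derivative_eq[OF F]) (simp add: algebra_simps)
  then have eq: "forward_derivative L F v (z + r *\<^sub>R v) = f r" if "r \<in> {0..t} - N" for r
    using that by blast
  have int: "(f has_integral (F (z + t *\<^sub>R v) - F z)) {0..t}"
    using f[OF t] by simp
  show ?thesis
    by (rule has_integral_spike[OF N _ int]) (rule eq)
qed

text \<open>
  The estimate of increments is applied to \<open>F\<close> and to \<open>-F\<close>. A step with negative \<open>t\<close> is read backwards, as a
  step with parameter \<open>-t\<close> from its endpoint, whose distance from \<open>x\<close> may be larger by \<open>norm v * R\<close>.
\<close>

lemma locally_uniform_directional_derivative:
  assumes F: "L-lipschitz_on UNIV F"
    and up: "approx_upper_semicontinuous_at (forward_derivative L F v) x"
    and lo: "approx_upper_semicontinuous_at (\<lambda>y. - forward_derivative L F v y) x"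
    and C: "C \<ge> 0" and \<epsilon>: "\<epsilon> > 0"
  obtains \<delta> where "\<delta> > 0" "\<And>p R t. 0 < R \<Longrightarrow> R < \<delta> \<Longrightarrow> dist x p \<le> C * R \<Longrightarrow> \<bar>t\<bar> \<le> R \<Longrightarrow>
      \<bar>F (p + t *\<^sub>R v) - F p - t * forward_derivative L F v x\<bar> \<le> \<epsilon> * R"
proof -
  have L: "L \<ge> 0" using F lipschitz_on_nonneg by blast
  let ?u = "forward_derivative L F v"
  have m: "?u \<in> borel_measurable borel" by (rule borel_measurable_forward_derivative[OF F])
  have M: "\<bar>?u y\<bar> \<le> L * norm v" for y by (rule abs_forward_derivative_le[OF L])
  have C': "C + norm v \<ge> 0" using C by simp
  obtain \<delta>1 where \<delta>1: "\<delta>1 > 0" "\<And>G p R t. L-lipschitz_on UNIV G \<Longrightarrow>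
      (\<And>z t. 0 \<le> t \<Longrightarrow> G (z + t *\<^sub>R v) - G z \<le> integral {0..t} (\<lambda>r. ?u (z + r *\<^sub>R v))) \<Longrightarrow>
      0 < R \<Longrightarrow> R < \<delta>1 \<Longrightarrow> dist x p \<le> (C + norm v) * R \<Longrightarrow> 0 \<le> t \<Longrightarrow> t \<le> R \<Longrightarrow>
      G (p + t *\<^sub>R v) - G p \<le> t * ?u x + \<epsilon> * R"
    by (rule increment_le_at_approx_upper_semicontinuity[OF m M up \<epsilon> C' L, of v]) blast
  obtain \<delta>2 where \<delta>2: "\<delta>2 > 0" "\<And>G p R t. L-lipschitz_on UNIV G \<Longrightarrow>
      (\<And>z t. 0 \<le> t \<Longrightarrow> G (z + t *\<^sub>R v) - G z \<le> integral {0..t} (\<lambda>r. - ?u (z + r *\<^sub>R v))) \<Longrightarrow>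
      0 < R \<Longrightarrow> R < \<delta>2 \<Longrightarrow> dist x p \<le> (C + norm v) * R \<Longrightarrow> 0 \<le> t \<Longrightarrow> t \<le> R \<Longrightarrow>
      G (p + t *\<^sub>R v) - G p \<le> t * (- ?u x) + \<epsilon> * R"
    by (rule increment_le_at_approx_upper_semicontinuity[where u = "\<lambda>y. - ?u y", OF _ _ lo \<epsilon> C' L, of "L * norm v" v])
       (use m M in auto)
  have int: "integral {0..t} (\<lambda>r. ?u (z + r *\<^sub>R v)) = F (z + t *\<^sub>R v) - F z" if "0 \<le> t" for z t
    using forward_derivative_has_integral[OF F that] by (rule integral_unique)
  have nF: "L-lipschitz_on UNIV (\<lambda>x. - F x)" using F by simp
  have pos: "\<bar>F (p + t *\<^sub>R v) - F p - t * ?u x\<bar> \<le> \<epsilon> * R"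
    if "0 < R" "R < min \<delta>1 \<delta>2" "dist x p \<le> (C + norm v) * R" "0 \<le> t" "t \<le> R" for p R t
    using \<delta>1(2)[OF F _ that(1) _ that(3-5)] \<delta>2(2)[OF nF _ that(1) _ that(3-5)] that(2)
    by (simp add: int abs_le_iff)
  show ?thesis
  proof (rule that[of "min \<delta>1 \<delta>2"])
    fix p R and t :: real
    assume R: "0 < R" "R < min \<delta>1 \<delta>2" and p: "dist x p \<le> C * R" and t: "\<bar>t\<bar> \<le> R"
    show "\<bar>F (p + t *\<^sub>R v) - F p - t * ?u x\<bar> \<le> \<epsilon> * R"
    proof (cases "t \<ge> 0")
      case True
      have "dist x p \<le> (C + norm v) * R" using p R by (simp add: distrib_right add_increasing2)
      then show ?thesis using pos[OF R _ True] t by simp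
    next
      case False
      have "dist x (p + t *\<^sub>R v) \<le> dist x p + norm (t *\<^sub>R v)"
        using dist_triangle[of x "p + t *\<^sub>R v" p] by (simp add: dist_norm)
      also have "\<dots> \<le> C * R + R * norm v" using p t by (simp add: add_mono mult_right_mono)
      finally have "dist x (p + t *\<^sub>R v) \<le> (C + norm v) * R" by (simp add: algebra_simps)
      from pos[OF R this, of "-t"] show ?thesis using False t by (simp add: abs_le_iff)
    qed
  qed (use \<delta>1 \<delta>2 in auto)
qed

text \<open>
  Linearity of the derivative comes from a walk along the axes: the point \<open>x + y\<close> is reached from \<open>x\<close> along the
  coordinate directions, and each partial derivative is uniform enough to be used from the intermediate points.
\<close>

theorem rademacher:
  fixes F :: "'a::euclidean_space \<Rightarrow> real"
  assumes F: "L-lipschitz_on UNIV F"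
  shows "AE x in lebesgue. F differentiable (at x)"
proof -
  let ?u = "forward_derivative L F"
  have m: "?u v \<in> borel_measurable borel" for v by (rule borel_measurable_forward_derivative[OF F])
  have "AE x in lebesgue. approx_upper_semicontinuous_at (?u b) x" for b
    by (rule AE_approx_upper_semicontinuous[OF m])
  moreover have "AE x in lebesgue. approx_upper_semicontinuous_at (\<lambda>y. - ?u b y) x" for b
    using m by (intro AE_approx_upper_semicontinuous) auto
  ultimately have "AE x in lebesgue. \<forall>b\<in>Basis. approx_upper_semicontinuous_at (?u b) x \<and>
      approx_upper_semicontinuous_at (\<lambda>y. - ?u b y) x"
    by (intro AE_finite_allI) auto
  then show ?thesis
  proof (rule AE_mp, intro AE_I2 impI)
    fix x assume x: "\<forall>b\<in>Basis. approx_upper_semicontinuous_at (?u b) x \<and>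
      approx_upper_semicontinuous_at (\<lambda>y. - ?u b y) x"
    have partial: "\<forall>\<epsilon>>0. \<exists>\<delta>>0. \<forall>y. norm y < \<delta> \<longrightarrow>
        \<bar>F (x + (\<Sum>b\<in>S. (y \<bullet> b) *\<^sub>R b)) - F x - (\<Sum>b\<in>S. (y \<bullet> b) * ?u b x)\<bar> \<le> \<epsilon> * norm y"
      if "S \<subseteq> Basis" for S
      using finite_subset[OF that finite_Basis] that
    proof (induction S rule: finite_induct)
      case empty
      show ?case by (auto intro: exI[of _ 1])
    next
      case (insert e S)
      show ?case
      proof (intro allI impI)
        fix \<epsilon> :: real assume "\<epsilon> > 0"
        then have \<epsilon>: "\<epsilon> / 2 > 0" by simp
        obtain \<delta>1 where \<delta>1: "\<delta>1 > 0" "\<And>y. norm y < \<delta>1 \<Longrightarrow>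
          \<bar>F (x + (\<Sum>b\<in>S. (y \<bullet> b) *\<^sub>R b)) - F x - (\<Sum>b\<in>S. (y \<bullet> b) * ?u b x)\<bar> \<le> \<epsilon> / 2 * norm y"
          using insert.IH[rule_format, OF _ \<epsilon>] insert.prems by auto
        obtain \<delta>2 where \<delta>2: "\<delta>2 > 0" "\<And>p R t. 0 < R \<Longrightarrow> R < \<delta>2 \<Longrightarrow>
            dist x p \<le> real DIM('a) * R \<Longrightarrow> \<bar>t\<bar> \<le> R \<Longrightarrow>
            \<bar>F (p + t *\<^sub>R e) - F p - t * ?u e x\<bar> \<le> \<epsilon> / 2 * R"
          by (rule locally_uniform_directional_derivative[OF F, of e x "real DIM('a)" "\<epsilon> / 2"])
             (use x insert \<epsilon> in auto)
        show "\<exists>\<delta>>0. \<forall>y. norm y < \<delta> \<longrightarrow> \<bar>F (x + (\<Sum>b\<in>insert e S. (y \<bullet> b) *\<^sub>R b)) - F x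
            - (\<Sum>b\<in>insert e S. (y \<bullet> b) * ?u b x)\<bar> \<le> \<epsilon> * norm y"
        proof (intro exI conjI allI impI)
          show "min \<delta>1 \<delta>2 > 0" using \<delta>1 \<delta>2 by simp
          fix y :: 'a assume y: "norm y < min \<delta>1 \<delta>2"
          show "\<bar>F (x + (\<Sum>b\<in>insert e S. (y \<bullet> b) *\<^sub>R b)) - F x
              - (\<Sum>b\<in>insert e S. (y \<bullet> b) * ?u b x)\<bar> \<le> \<epsilon> * norm y"
          proof (cases "y = 0")
            case False
            define p where "p = x + (\<Sum>b\<in>S. (y \<bullet> b) *\<^sub>R b)"
            have "norm (\<Sum>b\<in>S. (y \<bullet> b) *\<^sub>R b) \<le> (\<Sum>b\<in>S. norm y)"
              using insert.prems by (intro sum_norm_le) (auto simp: Basis_le_norm subset_iff)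
            also have "\<dots> \<le> real DIM('a) * norm y"
              using insert.prems by (simp add: mult_right_mono card_mono)
            finally have p: "dist x p \<le> real DIM('a) * norm y" by (simp add: p_def dist_norm)
            have split: "\<bar>A - B - d\<bar> \<le> c \<Longrightarrow> \<bar>B - D - s\<bar> \<le> c \<Longrightarrow> \<bar>A - D - (d + s)\<bar> \<le> c + c"
              for A B D c d s :: real by linarith
            have "\<bar>y \<bullet> e\<bar> \<le> norm y" using insert.prems by (simp add: Basis_le_norm)
            then have 1: "\<bar>F (p + (y \<bullet> e) *\<^sub>R e) - F p - (y \<bullet> e) * ?u e x\<bar> \<le> \<epsilon> / 2 * norm y"
              using \<delta>2(2)[OF _ _ p] False y by simp
            have 2: "\<bar>F p - F x - (\<Sum>b\<in>S. (y \<bullet> b) * ?u b x)\<bar> \<le> \<epsilon> / 2 * norm y"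
              using \<delta>1(2)[of y] y by (simp add: p_def)
            have "x + (\<Sum>b\<in>insert e S. (y \<bullet> b) *\<^sub>R b) = p + (y \<bullet> e) *\<^sub>R e"
              "(\<Sum>b\<in>insert e S. (y \<bullet> b) * ?u b x) = (y \<bullet> e) * ?u e x + (\<Sum>b\<in>S. (y \<bullet> b) * ?u b x)"
              using insert by (simp_all add: p_def algebra_simps)
            then show ?thesis using split[OF 1 2] by simp
          qed simp
        qed
      qed
    qed
    have "(F has_derivative (\<lambda>y. \<Sum>b\<in>Basis. (y \<bullet> b) * ?u b x)) (at x)"
      unfolding has_derivative_at_alt
    proof (intro conjI allI impI)
      show "bounded_linear (\<lambda>y. \<Sum>b\<in>Basis. (y \<bullet> b) * ?u b x)"
        by (intro bounded_linear_sum bounded_linear_mult_const bounded_linear_inner_left)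
      fix \<epsilon> :: real assume "\<epsilon> > 0"
      then obtain \<delta> where "\<delta> > 0" and \<delta>: "\<And>y. norm y < \<delta> \<Longrightarrow>
         \<bar>F (x + y) - F x - (\<Sum>b\<in>Basis. (y \<bullet> b) * ?u b x)\<bar> \<le> \<epsilon> * norm y"
        using partial[OF order_refl] by (auto simp: euclidean_representation)
      show "\<exists>\<delta>>0. \<forall>y. norm (y - x) < \<delta> \<longrightarrow>
          norm (F y - F x - (\<Sum>b\<in>Basis. ((y - x) \<bullet> b) * ?u b x)) \<le> \<epsilon> * norm (y - x)"
        using \<open>\<delta> > 0\<close> \<delta>[of "y - x" for y] by (intro exI[of _ \<delta>]) (auto simp del: inner_diff_left)
    qed
    then show "F differentiable (at x)" unfolding differentiable_def by blast
  qed
qed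

section \<open>Metric differentiability of countable Lipschitz families\<close>

lemma forward_derivative_eq_frechet_derivative:
  assumes F: "L-lipschitz_on UNIV F" and d: "F differentiable (at x)"
  shows "forward_derivative L F v x = frechet_derivative F (at x) v"
proof -
  let ?D = "frechet_derivative F (at x)"
  have D: "(F has_derivative ?D) (at (x + 0 *\<^sub>R v))"
    using d by (simp add: frechet_derivative_works)
  have "((\<lambda>t. F (x + t *\<^sub>R v)) has_derivative (\<lambda>t. ?D (t *\<^sub>R v))) (at (0::real))"
    by (rule has_derivative_compose[where f = "\<lambda>t. x + t *\<^sub>R v" and g = F, OF _ D]) (auto intro!: derivative_eq_intros)
  moreover have "(\<lambda>t. ?D (t *\<^sub>R v)) = (*) (?D v)"
    using linear_frechet_derivative[OF d] by (simp add: fun_eq_iff linear_cmul)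
  ultimately have "((\<lambda>t. F (x + t *\<^sub>R v)) has_field_derivative ?D v) (at 0)"
    by (simp add: has_field_derivative_def)
  then have lim: "((\<lambda>h. (F (x + h *\<^sub>R v) - F x) / h) \<longlongrightarrow> ?D v) (at 0)"
    by (simp add: DERIV_def)
  have "(\<lambda>k. 1 / real (Suc k)) \<longlonglongrightarrow> 0" using LIMSEQ_inverse_real_of_nat by (simp add: inverse_eq_divide)
  then have "filterlim (\<lambda>k. 1 / real (Suc k)) (at 0) sequentially"
    by (simp add: filterlim_at)
  from filterlim_compose[OF lim this]
  show ?thesis by (intro forward_derivative_eq[OF F]) (simp add: mult.commute)
qed

definition derivative_sup :: "(nat \<Rightarrow> 'a::euclidean_space \<Rightarrow> real) \<Rightarrow> 'a \<Rightarrow> 'a \<Rightarrow> real" where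
  "derivative_sup F x v = (SUP j. \<bar>frechet_derivative (F j) (at x) v\<bar>)"

context
  fixes F :: "nat \<Rightarrow> 'a::euclidean_space \<Rightarrow> real" and L :: real
  assumes lip: "\<And>i. L-lipschitz_on UNIV (F i)"
begin

lemma abs_frechet_derivative_le:
  assumes "F i differentiable (at x)"
  shows "\<bar>frechet_derivative (F i) (at x) v\<bar> \<le> L * norm v"
  using abs_forward_derivative_le[OF lipschitz_on_nonneg[OF lip], of "F i" v x]
    forward_derivative_eq_frechet_derivative[OF lip assms] by simp

context
  fixes x assumes diff: "\<And>i. F i differentiable (at x)"
begin

lemma bdd_above_frechet_derivatives: "bdd_above (range (\<lambda>j. \<bar>frechet_derivative (F j) (at x) v\<bar>))"
  using abs_frechet_derivative_le[OF diff] by (intro bdd_aboveI2) blast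

lemma frechet_derivative_le_derivative_sup: "\<bar>frechet_derivative (F i) (at x) v\<bar> \<le> derivative_sup F x v"
  unfolding derivative_sup_def by (rule cSUP_upper[OF UNIV_I bdd_above_frechet_derivatives])

lemma derivative_sup_le:
  "(\<And>i. \<bar>frechet_derivative (F i) (at x) v\<bar> \<le> c) \<Longrightarrow> derivative_sup F x v \<le> c"
  unfolding derivative_sup_def by (rule cSUP_least) auto

lemma derivative_sup_le_norm: "derivative_sup F x v \<le> L * norm v"
  using abs_frechet_derivative_le[OF diff] by (rule derivative_sup_le)

lemma seminorm_derivative_sup: "seminorm (derivative_sup F x)"
  unfolding seminorm_def
proof (intro conjI allI)
  have lin: "linear (frechet_derivative (F i) (at x))" for i
    by (rule linear_frechet_derivative[OF diff])
  show nonneg: "0 \<le> derivative_sup F x v" for v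
    using frechet_derivative_le_derivative_sup[of 0 v] by linarith
  show "derivative_sup F x (v + w) \<le> derivative_sup F x v + derivative_sup F x w" for v w
  proof (rule derivative_sup_le)
    fix i
    show "\<bar>frechet_derivative (F i) (at x) (v + w)\<bar> \<le> derivative_sup F x v + derivative_sup F x w"
      using frechet_derivative_le_derivative_sup[of i v] frechet_derivative_le_derivative_sup[of i w]
      by (simp add: linear_add[OF lin])
  qed
  have le: "derivative_sup F x (c *\<^sub>R v) \<le> \<bar>c\<bar> * derivative_sup F x v" for c v
    by (rule derivative_sup_le)
       (simp add: linear_cmul[OF lin] abs_mult mult_left_mono frechet_derivative_le_derivative_sup)
  show "derivative_sup F x (c *\<^sub>R v) = \<bar>c\<bar> * derivative_sup F x v" for c v
  proof (cases "c = 0")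
    case True
    then show ?thesis using le[of 0 v] nonneg[of "0 *\<^sub>R v"] by simp
  next
    case False
    have "derivative_sup F x v = derivative_sup F x (inverse c *\<^sub>R (c *\<^sub>R v))" using False by simp
    also have "\<dots> \<le> \<bar>inverse c\<bar> * derivative_sup F x (c *\<^sub>R v)" by (rule le)
    finally have "\<bar>c\<bar> * derivative_sup F x v \<le> derivative_sup F x (c *\<^sub>R v)"
      using False by (simp add: field_simps)
    then show ?thesis using le[of c v] by simp
  qed
qed

lemma derivative_sup_diff_le: "derivative_sup F x v \<le> derivative_sup F x w + L * dist v w"
proof -
  have "derivative_sup F x v = derivative_sup F x (w + (v - w))" by simp
  also have "\<dots> \<le> derivative_sup F x w + derivative_sup F x (v - w)"
    using seminorm_derivative_sup unfolding seminorm_def by blast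
  also have "\<dots> \<le> derivative_sup F x w + L * dist v w"
    using derivative_sup_le_norm[of "v - w"] by (simp add: dist_norm)
  finally show ?thesis .
qed

end

text \<open>
  A single function \<open>u\<close>, the supremum of the absolute directional derivatives, bounds the increments
  of all \<open>F i\<close> and their negatives along lines. This is what makes the estimate uniform in \<open>i\<close>.
\<close>

lemma AE_increments_le_derivative_sup_direction:
  "AE x in lebesgue. \<forall>\<epsilon>>0. \<exists>\<delta>>0. \<forall>R. 0 < R \<and> R < \<delta> \<longrightarrow>
     (\<forall>i. \<bar>F i (x + R *\<^sub>R v) - F i x\<bar> \<le> R * derivative_sup F x v + \<epsilon> * R)"
proof -
  have L: "L \<ge> 0" using lip lipschitz_on_nonneg by blast
  let ?h = "\<lambda>j. forward_derivative L (F j) v"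
  define u where "u y = (SUP j. \<bar>?h j y\<bar>)" for y
  have bdd: "bdd_above (range (\<lambda>j. \<bar>?h j y\<bar>))" for y
    by (intro bdd_aboveI2[where M = "L * norm v"] abs_forward_derivative_le L)
  have hu: "\<bar>?h j y\<bar> \<le> u y" for j y unfolding u_def by (rule cSUP_upper[OF UNIV_I bdd])
  have "u y \<le> L * norm v" for y
    unfolding u_def by (intro cSUP_least abs_forward_derivative_le L) auto
  then have M: "\<bar>u y\<bar> \<le> L * norm v" for y using hu[of 0 y] by (smt (verit))
  have [measurable]: "?h j \<in> borel_measurable borel" for j
    by (rule borel_measurable_forward_derivative[OF lip])
  have um: "u \<in> borel_measurable borel"
    unfolding u_def by (rule borel_measurable_cSUP) (use bdd in auto)
  have int: "G (z + t *\<^sub>R v) - G z \<le> integral {0..t} (\<lambda>r. u (z + r *\<^sub>R v))"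
    if G: "G = F i \<or> G = (\<lambda>x. - F i x)" and t: "0 \<le> t" for G i z t
  proof -
    have D: "(\<lambda>r. ?h i (z + r *\<^sub>R v)) integrable_on {0..t}"
        "integral {0..t} (\<lambda>r. ?h i (z + r *\<^sub>R v)) = F i (z + t *\<^sub>R v) - F i z"
      using forward_derivative_has_integral[OF lip t] by (auto simp: integrable_on_def integral_unique)
    have "norm (integral {0..t} (\<lambda>r. ?h i (z + r *\<^sub>R v))) \<le> integral {0..t} (\<lambda>r. u (z + r *\<^sub>R v))"
      using hu by (intro integral_norm_bound_integral D bounded_borel_integrable_along_line[OF um M]) auto
    then show ?thesis using G D by auto
  qed
  have "AE x in lebesgue. \<forall>i. F i differentiable (at x)"
    unfolding AE_all_countable using rademacher[OF lip] by blast
  moreover have "AE x in lebesgue. approx_upper_semicontinuous_at u x"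
    by (rule AE_approx_upper_semicontinuous[OF um])
  ultimately show ?thesis
  proof eventually_elim
    fix x assume diff: "\<forall>i. F i differentiable (at x)" and x: "approx_upper_semicontinuous_at u x"
    have ux: "u x = derivative_sup F x v"
      unfolding u_def derivative_sup_def
      using diff by (simp add: forward_derivative_eq_frechet_derivative[OF lip])
    show "\<forall>\<epsilon>>0. \<exists>\<delta>>0. \<forall>R. 0 < R \<and> R < \<delta> \<longrightarrow>
     (\<forall>i. \<bar>F i (x + R *\<^sub>R v) - F i x\<bar> \<le> R * derivative_sup F x v + \<epsilon> * R)"
    proof (intro allI impI)
      fix \<epsilon> :: real assume \<epsilon>: "\<epsilon> > 0"
      obtain \<delta> where \<delta>: "\<delta> > 0" "\<And>G p R t. L-lipschitz_on UNIV G \<Longrightarrow>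
        (\<And>z t. 0 \<le> t \<Longrightarrow> G (z + t *\<^sub>R v) - G z \<le> integral {0..t} (\<lambda>r. u (z + r *\<^sub>R v))) \<Longrightarrow>
        0 < R \<Longrightarrow> R < \<delta> \<Longrightarrow> dist x p \<le> 0 * R \<Longrightarrow> 0 \<le> t \<Longrightarrow> t \<le> R \<Longrightarrow>
        G (p + t *\<^sub>R v) - G p \<le> t * u x + \<epsilon> * R"
        by (rule increment_le_at_approx_upper_semicontinuity[OF um M x \<epsilon> order_refl L, of v]) blast
      have "\<bar>F i (x + R *\<^sub>R v) - F i x\<bar> \<le> R * derivative_sup F x v + \<epsilon> * R" if R: "0 < R" "R < \<delta>" for R i
      proof -
        have nF: "L-lipschitz_on UNIV (\<lambda>x. - F i x)" using lip by simp
        have "F i (x + R *\<^sub>R v) - F i x \<le> R * u x + \<epsilon> * R"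
          by (rule \<delta>(2)[OF lip int R]) (use R in auto)
        moreover have "- F i (x + R *\<^sub>R v) - - F i x \<le> R * u x + \<epsilon> * R"
          by (rule \<delta>(2)[OF nF int R]) (use R in auto)
        ultimately show ?thesis by (simp add: ux abs_le_iff)
      qed
      then show "\<exists>\<delta>>0. \<forall>R. 0 < R \<and> R < \<delta> \<longrightarrow>
        (\<forall>i. \<bar>F i (x + R *\<^sub>R v) - F i x\<bar> \<le> R * derivative_sup F x v + \<epsilon> * R)"
        using \<delta>(1) by blast
    qed
  qed
qed

end

lemma finite_sphere_net:
  fixes D :: "'a::euclidean_space set"
  assumes D: "\<And>X. open X \<Longrightarrow> X \<noteq> {} \<Longrightarrow> \<exists>d\<in>D. d \<in> X" and \<epsilon>: "\<epsilon> > 0"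
  obtains T where "finite T" "T \<subseteq> D" "\<And>w. norm w = 1 \<Longrightarrow> \<exists>v\<in>T. dist w v < \<epsilon>"
proof -
  have "sphere (0::'a) 1 \<subseteq> (\<Union>v\<in>D. ball v \<epsilon>)"
  proof
    fix w :: 'a
    obtain v where "v \<in> D" "v \<in> ball w \<epsilon>" using D[of "ball w \<epsilon>"] \<epsilon> by auto
    then show "w \<in> (\<Union>v\<in>D. ball v \<epsilon>)" by (auto simp: dist_commute)
  qed
  then obtain T where "T \<subseteq> D" "finite T" "sphere (0::'a) 1 \<subseteq> (\<Union>v\<in>T. ball v \<epsilon>)"
    by (rule compactE_image[OF compact_sphere, rotated]) auto
  then show ?thesis
    by (intro that[of T]) (auto simp: dist_commute subset_iff)
qed

text \<open>
  The exceptional null set of the previous estimate depends on the direction. A countable dense set of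
  directions is harmless, and a finite net of the unit sphere taken from it handles all directions at once,
  because both sides are Lipschitz in the direction.
\<close>

lemma AE_increments_le_derivative_sup:
  fixes F :: "nat \<Rightarrow> 'a::euclidean_space \<Rightarrow> real"
  assumes lip: "\<And>i. L-lipschitz_on UNIV (F i)"
  shows "AE x in lebesgue. (\<forall>i. F i differentiable (at x)) \<and>
    (\<forall>\<epsilon>>0. \<exists>\<delta>>0. \<forall>y. norm y < \<delta> \<longrightarrow> (\<forall>i. \<bar>F i (x + y) - F i x\<bar> \<le> derivative_sup F x y + \<epsilon> * norm y))"
proof -
  have L: "L \<ge> 0" using lip lipschitz_on_nonneg by blast
  obtain D :: "'a set" where D: "countable D" "\<And>X. open X \<Longrightarrow> X \<noteq> {} \<Longrightarrow> \<exists>d\<in>D. d \<in> X"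
    using countable_dense_exists by (metis (no_types))
  have "AE x in lebesgue. \<forall>i. F i differentiable (at x)"
    unfolding AE_all_countable using rademacher[OF lip] by blast
  moreover have "AE x in lebesgue. \<forall>v\<in>D. \<forall>\<epsilon>>0. \<exists>\<delta>>0. \<forall>R. 0 < R \<and> R < \<delta> \<longrightarrow>
     (\<forall>i. \<bar>F i (x + R *\<^sub>R v) - F i x\<bar> \<le> R * derivative_sup F x v + \<epsilon> * R)"
    using AE_increments_le_derivative_sup_direction[of L F, OF lip] D(1) by (subst AE_ball_countable) auto
  ultimately show ?thesis
  proof eventually_elim
    fix x assume diff: "\<forall>i. F i differentiable (at x)"
      and dir: "\<forall>v\<in>D. \<forall>\<epsilon>>0. \<exists>\<delta>>0. \<forall>R. 0 < R \<and> R < \<delta> \<longrightarrow>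
     (\<forall>i. \<bar>F i (x + R *\<^sub>R v) - F i x\<bar> \<le> R * derivative_sup F x v + \<epsilon> * R)"
    have "\<exists>\<delta>>0. \<forall>y. norm y < \<delta> \<longrightarrow> (\<forall>i. \<bar>F i (x + y) - F i x\<bar> \<le> derivative_sup F x y + \<epsilon> * norm y)"
      if \<epsilon>: "\<epsilon> > 0" for \<epsilon>
    proof -
      have \<epsilon>': "\<epsilon> / (4 * (L + 1)) > 0" "\<epsilon> / 2 > 0" using \<epsilon> L by auto
      obtain T where T: "finite T" "T \<subseteq> D" and net: "\<And>w. norm w = 1 \<Longrightarrow> \<exists>v\<in>T. dist w v < \<epsilon> / (4 * (L + 1))"
        using finite_sphere_net[OF D(2) \<epsilon>'(1)] by blast
      have "\<forall>v\<in>T. \<exists>\<delta>>0. \<forall>R. 0 < R \<and> R < \<delta> \<longrightarrow>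
        (\<forall>i. \<bar>F i (x + R *\<^sub>R v) - F i x\<bar> \<le> R * derivative_sup F x v + \<epsilon> / 2 * R)"
        using dir T \<epsilon>'(2) by blast
      then obtain d where d: "\<And>v. v \<in> T \<Longrightarrow> d v > 0" and dT: "\<And>v R i. v \<in> T \<Longrightarrow> 0 < R \<Longrightarrow> R < d v \<Longrightarrow>
         \<bar>F i (x + R *\<^sub>R v) - F i x\<bar> \<le> R * derivative_sup F x v + \<epsilon> / 2 * R"
        by metis
      define \<delta> where "\<delta> = Min (insert 1 (d ` T))"
      have \<delta>: "\<delta> > 0" "\<And>v. v \<in> T \<Longrightarrow> \<delta> \<le> d v"
        using T(1) d by (auto simp: \<delta>_def)
      have "\<bar>F i (x + y) - F i x\<bar> \<le> derivative_sup F x y + \<epsilon> * norm y" if y: "norm y < \<delta>" for y i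
      proof (cases "y = 0")
        case True
        have "0 \<le> derivative_sup F x 0"
          using seminorm_derivative_sup[of L F, OF lip] diff unfolding seminorm_def by blast
        then show ?thesis using True by simp
      next
        case False
        define R where "R = norm y"
        define w where "w = y /\<^sub>R R"
        have R: "R > 0" "R < \<delta>" and w: "norm w = 1" and yw: "y = R *\<^sub>R w"
          using False y by (auto simp: R_def w_def)
        obtain v where v: "v \<in> T" "dist w v < \<epsilon> / (4 * (L + 1))" using net[OF w] by blast
        have Lv: "L * dist w v \<le> \<epsilon> / 4"
        proof -
          have "L * dist w v \<le> L * (\<epsilon> / (4 * (L + 1)))" using v L by (intro mult_left_mono) auto
          also have "\<dots> \<le> \<epsilon> / 4" using L \<epsilon> by (simp add: field_simps)
          finally show ?thesis .
        qed
        have "\<bar>F i (x + R *\<^sub>R w) - F i (x + R *\<^sub>R v)\<bar> \<le> L * dist (x + R *\<^sub>R w) (x + R *\<^sub>R v)"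
          using lipschitz_onD[OF lip, of "x + R *\<^sub>R w" "x + R *\<^sub>R v" i] by (simp only: dist_real_def UNIV_I)
        also have "\<dots> = R * (L * dist w v)"
          using R by (simp add: dist_norm flip: scaleR_right_diff_distrib)
        also have "\<dots> \<le> R * (\<epsilon> / 4)" using Lv R by (intro mult_left_mono) auto
        finally have 1: "\<bar>F i (x + R *\<^sub>R w) - F i (x + R *\<^sub>R v)\<bar> \<le> R * (\<epsilon> / 4)" .
        have 2: "\<bar>F i (x + R *\<^sub>R v) - F i x\<bar> \<le> R * derivative_sup F x v + \<epsilon> / 2 * R"
          using dT[OF v(1)] R \<delta>(2)[OF v(1)] by auto
        have "derivative_sup F x v \<le> derivative_sup F x w + L * dist v w"
          using derivative_sup_diff_le[of L F, OF lip] diff by blast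
        then have "derivative_sup F x v \<le> derivative_sup F x w + \<epsilon> / 4" using Lv by (simp add: dist_commute)
        then have 3: "R * derivative_sup F x v \<le> R * (derivative_sup F x w + \<epsilon> / 4)" using R by (intro mult_left_mono) auto
        have 4: "derivative_sup F x y = R * derivative_sup F x w"
          using seminorm_derivative_sup[of L F x, OF lip] diff R unfolding seminorm_def yw by auto
        have "\<bar>F i (x + y) - F i x\<bar> \<le> R * (\<epsilon> / 4) + (R * (derivative_sup F x w + \<epsilon> / 4) + \<epsilon> / 2 * R)"
          using 1 2 3 unfolding yw by linarith
        also have "\<dots> = derivative_sup F x y + \<epsilon> * norm y" unfolding 4 by (simp add: R_def algebra_simps)
        finally show ?thesis .
      qed
      then show ?thesis using \<delta>(1) by blast
    qed
    then show "(\<forall>i. F i differentiable (at x)) \<and>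
      (\<forall>\<epsilon>>0. \<exists>\<delta>>0. \<forall>y. norm y < \<delta> \<longrightarrow> (\<forall>i. \<bar>F i (x + y) - F i x\<bar> \<le> derivative_sup F x y + \<epsilon> * norm y))"
      using diff by blast
  qed
qed

text \<open>
  For each direction of a finite net, one index almost attains the supremum. Only these finitely many
  functions matter, so their differentiability at \<open>x\<close> gives a common \<open>\<delta>\<close>.
\<close>

lemma some_increment_ge_derivative_sup:
  fixes F :: "nat \<Rightarrow> 'a::euclidean_space \<Rightarrow> real"
  assumes lip: "\<And>i. L-lipschitz_on UNIV (F i)" and diff: "\<And>i. F i differentiable (at x)" and \<epsilon>: "\<epsilon> > 0"
  obtains \<delta> where "\<delta> > 0"
    "\<And>y. norm y < \<delta> \<Longrightarrow> \<exists>i. derivative_sup F x y \<le> \<bar>F i (x + y) - F i x\<bar> + \<epsilon> * norm y"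
proof -
  let ?D = "\<lambda>i. frechet_derivative (F i) (at x)"
  have L: "L \<ge> 0" using lip lipschitz_on_nonneg by blast
  have \<epsilon>': "\<epsilon> / (4 * (L + 1)) > 0" "\<epsilon> / 4 > 0" using \<epsilon> L by auto
  obtain T :: "'a set" where T: "finite T" and net: "\<And>w. norm w = 1 \<Longrightarrow> \<exists>v\<in>T. dist w v < \<epsilon> / (4 * (L + 1))"
    by (rule finite_sphere_net[of UNIV, OF _ \<epsilon>'(1)]) auto
  have "\<exists>i. derivative_sup F x v < \<bar>?D i v\<bar> + \<epsilon> / 4" for v
  proof (rule ccontr)
    assume "\<nexists>i. derivative_sup F x v < \<bar>?D i v\<bar> + \<epsilon> / 4"
    then have "derivative_sup F x v \<le> derivative_sup F x v - \<epsilon> / 4"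
      by (intro derivative_sup_le[of L F, OF lip diff]) (auto simp: not_less algebra_simps)
    then show False using \<epsilon> by simp
  qed
  then obtain J where J: "\<And>v. derivative_sup F x v < \<bar>?D (J v) v\<bar> + \<epsilon> / 4" by metis
  have "\<exists>\<delta>>0. \<forall>y. norm y < \<delta> \<longrightarrow> \<bar>F i (x + y) - F i x - ?D i y\<bar> \<le> \<epsilon> / 4 * norm y" for i
  proof -
    have "(F i has_derivative ?D i) (at x)" using diff frechet_derivative_works by blast
    then obtain \<delta> where "\<delta> > 0" "\<And>y. norm (y - x) < \<delta> \<Longrightarrow> norm (F i y - F i x - ?D i (y - x)) \<le> \<epsilon> / 4 * norm (y - x)"
      using \<epsilon>'(2) unfolding has_derivative_at_alt by blast
    from this(1) this(2)[of "x + y" for y] show ?thesis by auto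
  qed
  then obtain d where d: "\<And>i. d i > 0" and dF: "\<And>i y. norm y < d i \<Longrightarrow> \<bar>F i (x + y) - F i x - ?D i y\<bar> \<le> \<epsilon> / 4 * norm y"
    by metis
  define \<delta> where "\<delta> = Min (insert 1 ((\<lambda>v. d (J v)) ` T))"
  have \<delta>: "\<delta> > 0" "\<And>v. v \<in> T \<Longrightarrow> \<delta> \<le> d (J v)" using T d by (auto simp: \<delta>_def)
  have "\<exists>i. derivative_sup F x y \<le> \<bar>F i (x + y) - F i x\<bar> + \<epsilon> * norm y" if y: "norm y < \<delta>" for y
  proof (cases "y = 0")
    case True
    then show ?thesis using derivative_sup_le_norm[of L F x 0, OF lip diff] by auto
  next
    case False
    define R where "R = norm y"
    define w where "w = y /\<^sub>R R"
    have R: "R > 0" "R < \<delta>" and w: "norm w = 1" and yw: "y = R *\<^sub>R w"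
      using False y by (auto simp: R_def w_def)
    obtain v where v: "v \<in> T" "dist w v < \<epsilon> / (4 * (L + 1))" using net[OF w] by blast
    have Lv: "L * dist w v \<le> \<epsilon> / 4"
    proof -
      have "L * dist w v \<le> L * (\<epsilon> / (4 * (L + 1)))" using v L by (intro mult_left_mono) auto
      also have "\<dots> \<le> \<epsilon> / 4" using L \<epsilon> by (simp add: field_simps)
      finally show ?thesis .
    qed
    let ?i = "J v"
    have lin: "linear (?D ?i)" by (rule linear_frechet_derivative[OF diff])
    have "?D ?i v - ?D ?i w = ?D ?i (v - w)" by (simp add: linear_diff[OF lin])
    moreover have "\<bar>?D ?i (v - w)\<bar> \<le> L * dist w v"
      using abs_frechet_derivative_le[of L F ?i x "v - w", OF lip diff] by (simp add: dist_norm norm_minus_commute)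
    ultimately have "\<bar>?D ?i v\<bar> \<le> \<bar>?D ?i w\<bar> + \<epsilon> / 4" using Lv by linarith
    moreover have "derivative_sup F x w \<le> derivative_sup F x v + \<epsilon> / 4"
      using derivative_sup_diff_le[of L F x w v, OF lip diff] Lv by linarith
    ultimately have "derivative_sup F x w \<le> \<bar>?D ?i w\<bar> + 3 * \<epsilon> / 4" using J[of v] by linarith
    then have "R * derivative_sup F x w \<le> R * (\<bar>?D ?i w\<bar> + 3 * \<epsilon> / 4)" using R by (intro mult_left_mono) auto
    then have "R * derivative_sup F x w \<le> R * \<bar>?D ?i w\<bar> + 3 / 4 * (\<epsilon> * R)" by (simp add: algebra_simps)
    moreover have "derivative_sup F x y = R * derivative_sup F x w"
      using seminorm_derivative_sup[of L F x, OF lip diff] R unfolding seminorm_def yw by auto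
    moreover have "\<bar>?D ?i y\<bar> = R * \<bar>?D ?i w\<bar>" using R by (simp add: yw linear_cmul[OF lin] abs_mult)
    moreover have "\<bar>F ?i (x + y) - F ?i x - ?D ?i y\<bar> \<le> 1 / 4 * (\<epsilon> * R)"
      using dF[of y ?i] R \<delta>(2)[OF v(1)] by (simp add: R_def)
    ultimately have "derivative_sup F x y \<le> \<bar>F ?i (x + y) - F ?i x\<bar> + \<epsilon> * R"
      using \<epsilon> R by linarith
    then show ?thesis unfolding R_def by blast
  qed
  then show ?thesis using that \<delta>(1) by blast
qed

section \<open>Closed pairs in spaces of small inductive dimension\<close>

definition closed_disjoint_pairs :: "'i set \<Rightarrow> 'a topology \<Rightarrow> ('i \<Rightarrow> 'a set) \<Rightarrow> ('i \<Rightarrow> 'a set) \<Rightarrow> bool" where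
  "closed_disjoint_pairs I X A B \<longleftrightarrow>
     (\<forall>i\<in>I. closedin X (A i) \<and> closedin X (B i) \<and> A i \<inter> B i = {})"

text \<open>
  For normal \<open>X\<close>, \<open>F = topspace X\<close> and \<open>card I = m\<close>, this says that no family of \<open>m\<close> pairs in \<open>X\<close> is
  essential, which characterises covering dimension at most \<open>m - 1\<close>.
\<close>

definition enlargeable_over :: "'i set \<Rightarrow> 'a topology \<Rightarrow> 'a set \<Rightarrow> bool" where
  "enlargeable_over I X F \<longleftrightarrow>
     (\<forall>A B. closed_disjoint_pairs I X A B \<longrightarrow>
        (\<exists>A' B'. closed_disjoint_pairs I X A' B' \<and> (\<forall>i\<in>I. A i \<subseteq> A' i \<and> B i \<subseteq> B' i) \<and>
                 F \<subseteq> (\<Union>i\<in>I. A' i \<union> B' i)))"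

lemma enlargeable_overE:
  assumes "enlargeable_over I X F" "closed_disjoint_pairs I X A B"
  obtains A' B' where "closed_disjoint_pairs I X A' B'" "\<forall>i\<in>I. A i \<subseteq> A' i \<and> B i \<subseteq> B' i"
    "F \<subseteq> (\<Union>i\<in>I. A' i \<union> B' i)"
proof -
  have "\<exists>A' B'. closed_disjoint_pairs I X A' B' \<and> (\<forall>i\<in>I. A i \<subseteq> A' i \<and> B i \<subseteq> B' i) \<and>
                 F \<subseteq> (\<Union>i\<in>I. A' i \<union> B' i)"
    using assms(1)[unfolded enlargeable_over_def, rule_format, OF assms(2)] .
  then show ?thesis using that by (elim exE conjE)
qed

text \<open>
  The union of a pair in \<open>X\<close> and an enlargement, inside \<open>F\<close>, of its trace on \<open>F\<close> is still disjoint.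
\<close>

lemma enlargeable_over_closed_subspace:
  assumes F: "closedin X F" and en: "enlargeable_over I (subtopology X F) F"
  shows "enlargeable_over I X F"
  unfolding enlargeable_over_def
proof (intro allI impI)
  fix A B assume AB: "closed_disjoint_pairs I X A B"
  then have AF: "closed_disjoint_pairs I (subtopology X F) (\<lambda>i. A i \<inter> F) (\<lambda>i. B i \<inter> F)"
    unfolding closed_disjoint_pairs_def by (auto simp: closedin_subtopology)
  obtain A' B' where A'B': "closed_disjoint_pairs I (subtopology X F) A' B'"
    "\<forall>i\<in>I. A i \<inter> F \<subseteq> A' i \<and> B i \<inter> F \<subseteq> B' i" "F \<subseteq> (\<Union>i\<in>I. A' i \<union> B' i)"
    by (rule enlargeable_overE[OF en AF])
  have cl: "closedin X (A' i)" "A' i \<subseteq> F" "closedin X (B' i)" "B' i \<subseteq> F" "A' i \<inter> B' i = {}" if "i \<in> I" for i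
    using A'B'(1) that F unfolding closed_disjoint_pairs_def
    by (auto dest: closedin_trans_full simp: closedin_closed_subtopology[OF F])
  show "\<exists>A' B'. closed_disjoint_pairs I X A' B' \<and> (\<forall>i\<in>I. A i \<subseteq> A' i \<and> B i \<subseteq> B' i) \<and>
                 F \<subseteq> (\<Union>i\<in>I. A' i \<union> B' i)"
  proof (intro exI conjI)
    show "closed_disjoint_pairs I X (\<lambda>i. A i \<union> A' i) (\<lambda>i. B i \<union> B' i)"
      using AB A'B'(2) cl unfolding closed_disjoint_pairs_def by (fastforce intro: closedin_Un)
  qed (use A'B'(3) in auto)
qed

lemma enlargeable_over_finite_Union:
  assumes "finite \<F>" "\<And>F. F \<in> \<F> \<Longrightarrow> enlargeable_over I X F"
  shows "enlargeable_over I X (\<Union>\<F>)"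
  using assms
proof (induction \<F> rule: finite_induct)
  case empty
  show ?case unfolding enlargeable_over_def by auto
next
  case (insert F \<F>)
  show ?case unfolding enlargeable_over_def
  proof (intro allI impI)
    fix A B assume AB: "closed_disjoint_pairs I X A B"
    obtain A1 B1 where 1: "closed_disjoint_pairs I X A1 B1" "\<forall>i\<in>I. A i \<subseteq> A1 i \<and> B i \<subseteq> B1 i"
        "F \<subseteq> (\<Union>i\<in>I. A1 i \<union> B1 i)"
      by (rule enlargeable_overE[OF insert.prems[OF insertI1] AB])
    obtain A2 B2 where 2: "closed_disjoint_pairs I X A2 B2" "\<forall>i\<in>I. A1 i \<subseteq> A2 i \<and> B1 i \<subseteq> B2 i"
        "\<Union>\<F> \<subseteq> (\<Union>i\<in>I. A2 i \<union> B2 i)"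
      by (rule enlargeable_overE[OF insert.IH[OF insert.prems[OF insertI2]] 1(1)])
    show "\<exists>A' B'. closed_disjoint_pairs I X A' B' \<and> (\<forall>i\<in>I. A i \<subseteq> A' i \<and> B i \<subseteq> B' i) \<and>
                 \<Union>(insert F \<F>) \<subseteq> (\<Union>i\<in>I. A' i \<union> B' i)"
    proof (intro exI conjI)
      show "\<forall>i\<in>I. A i \<subseteq> A2 i \<and> B i \<subseteq> B2 i" using 1(2) 2(2) by blast
      have "(\<Union>i\<in>I. A1 i \<union> B1 i) \<subseteq> (\<Union>i\<in>I. A2 i \<union> B2 i)" using 2(2) by blast
      then show "\<Union>(insert F \<F>) \<subseteq> (\<Union>i\<in>I. A2 i \<union> B2 i)" using 1(3) 2(3) by auto
    qed (rule 2(1))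
  qed
qed

lemma thicken_closed_disjoint_pairs:
  assumes X: "normal_space X" and AB: "closed_disjoint_pairs I X A B"
  obtains U V where "\<And>i. i \<in> I \<Longrightarrow> openin X (U i) \<and> openin X (V i) \<and> A i \<subseteq> U i \<and> B i \<subseteq> V i"
    "closed_disjoint_pairs I X (\<lambda>i. X closure_of U i) (\<lambda>i. X closure_of V i)"
proof -
  have "\<exists>U V. openin X U \<and> openin X V \<and> A i \<subseteq> U \<and> B i \<subseteq> V \<and> X closure_of U \<inter> X closure_of V = {}"
    if "i \<in> I" for i
  proof -
    have "closedin X (A i)" "closedin X (B i)" "disjnt (A i) (B i)"
      using AB that by (auto simp: closed_disjoint_pairs_def disjnt_def)
    then show ?thesis using X unfolding normal_space_disjoint_closures by (auto simp: disjnt_def)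
  qed
  then obtain U V where "\<And>i. i \<in> I \<Longrightarrow> openin X (U i) \<and> openin X (V i) \<and> A i \<subseteq> U i \<and> B i \<subseteq> V i \<and>
      X closure_of U i \<inter> X closure_of V i = {}" by metis
  then show ?thesis by (intro that[of U V]) (auto simp: closed_disjoint_pairs_def)
qed

text \<open>
  Induction on the number of pairs. Cover one of the sets, \<open>A m\<close>, by finitely many open sets that miss \<open>B m\<close> and
  whose boundaries have smaller dimension, and let \<open>W\<close> be their union. By induction the other pairs can be
  enlarged so that they cover a neighbourhood \<open>N\<close> of the finitely many boundaries, which contain the boundary of
  \<open>W\<close>. Then \<open>closure W - N\<close>, joined with \<open>A m\<close>, and the complement of \<open>W\<close> are disjoint closed sets that cover the rest.
  The induction hypothesis is used for one boundary at a time, and \<open>enlargeable_over_finite_Union\<close> combines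
  the results: in a compact Hausdorff space a finite union of closed sets of small dimension need not
  have small dimension, but it inherits enlargeability.
\<close>

theorem dim_le_imp_enlargeable_over:
  assumes "finite I" "compact_space X" "Hausdorff_space X" "X dim_le (int (card I) - 1)"
  shows "enlargeable_over I X (topspace X)"
  using assms
proof (induction I arbitrary: X rule: finite_induct)
  case empty
  then have "topspace X = {}" by simp
  then show ?case unfolding enlargeable_over_def by auto
next
  case (insert m I X)
  have normal: "normal_space X"
    using insert.prems compact_Hausdorff_or_regular_imp_normal_space by blast
  show ?case unfolding enlargeable_over_def
  proof (intro allI impI)
    fix A B assume AB: "closed_disjoint_pairs (insert m I) X A B"
    then have Am: "closedin X (A m)" and Bm: "closedin X (B m)" and ABm: "A m \<inter> B m = {}"
      and ABI: "closed_disjoint_pairs I X A B"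
      by (auto simp: closed_disjoint_pairs_def)
    have "X dim_le int (card I)" using insert by simp
    then have nb: "\<exists>U. a \<in> U \<and> U \<subseteq> V \<and> openin X U \<and> subtopology X (X frontier_of U) dim_le (int (card I) - 1)"
      if "openin X V" "a \<in> V" for a V
      using that dimension_le.simps[of X "int (card I)"] by auto
    have "\<exists>U. a \<in> U \<and> U \<subseteq> topspace X - B m \<and> openin X U \<and>
        subtopology X (X frontier_of U) dim_le (int (card I) - 1)" if "a \<in> A m" for a
      using that Am ABm closedin_subset by (intro nb openin_diff Bm) auto
    then obtain U where U: "\<And>a. a \<in> A m \<Longrightarrow> a \<in> U a \<and> U a \<subseteq> topspace X - B m \<and> openin X (U a) \<and>
        subtopology X (X frontier_of (U a)) dim_le (int (card I) - 1)" by metis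
    have "compactin X (A m)" using insert.prems Am closedin_compact_space by blast
    then obtain S where S: "finite S" "S \<subseteq> A m" "A m \<subseteq> (\<Union>a\<in>S. U a)"
      unfolding compactin_def using U
      by (elim conjE allE[of _ "U ` A m"]) (smt (verit, best) UN_I ball_imageD finite_subset_image image_iff subsetI)
    let ?\<F> = "(\<lambda>a. X frontier_of (U a)) ` S"
    have "enlargeable_over I X (X frontier_of (U a))" if "a \<in> S" for a
    proof (rule enlargeable_over_closed_subspace)
      show cl: "closedin X (X frontier_of (U a))" by (rule closedin_frontier_of)
      have "topspace (subtopology X (X frontier_of (U a))) = X frontier_of (U a)"
        by (simp add: frontier_of_subset_topspace inf_absorb2)
      moreover have "compact_space (subtopology X (X frontier_of (U a)))"
        using insert.prems cl by (simp add: closedin_compact_space compact_space_subtopology)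
      ultimately show "enlargeable_over I (subtopology X (X frontier_of (U a))) (X frontier_of (U a))"
        using insert.IH[of "subtopology X (X frontier_of (U a))"] insert.prems U S that
        by (auto simp: Hausdorff_space_subtopology)
    qed
    then have en: "enlargeable_over I X (\<Union>?\<F>)"
      using S(1) by (intro enlargeable_over_finite_Union) auto
    obtain A1 B1 where 1: "closed_disjoint_pairs I X A1 B1" "\<forall>i\<in>I. A i \<subseteq> A1 i \<and> B i \<subseteq> B1 i"
        "\<Union>?\<F> \<subseteq> (\<Union>i\<in>I. A1 i \<union> B1 i)"
      by (rule enlargeable_overE[OF en ABI])
    obtain P Q where PQ: "\<And>i. i \<in> I \<Longrightarrow> openin X (P i) \<and> openin X (Q i) \<and> A1 i \<subseteq> P i \<and> B1 i \<subseteq> Q i"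
      and clPQ: "closed_disjoint_pairs I X (\<lambda>i. X closure_of P i) (\<lambda>i. X closure_of Q i)"
      by (rule thicken_closed_disjoint_pairs[OF normal 1(1)]) blast
    define N where "N = (\<Union>i\<in>I. P i \<union> Q i)"
    define W where "W = (\<Union>a\<in>S. U a)"
    have N: "openin X N" using PQ by (auto simp: N_def)
    have W: "openin X W" using U S(2) by (auto simp: W_def)
    have "\<Union>?\<F> \<subseteq> N" using 1(3) PQ unfolding N_def by blast
    moreover have "X closure_of W \<subseteq> W \<union> \<Union>?\<F>"
    proof -
      have "X closure_of W = (\<Union>a\<in>S. X closure_of (U a))"
        using S(1) unfolding W_def by (simp add: closure_of_Union image_image)
      also have "\<dots> \<subseteq> W \<union> \<Union>?\<F>"
        using U S(2) by (fastforce simp: W_def frontier_of_def interior_of_openin)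
      finally show ?thesis .
    qed
    ultimately have clW: "X closure_of W \<subseteq> W \<union> N" by blast
    have AW: "A m \<subseteq> W" using S(3) by (simp add: W_def)
    have BW: "B m \<subseteq> topspace X - W" using U S(2) closedin_subset[OF Bm] by (fastforce simp: W_def)
    let ?A = "\<lambda>i. if i = m then A m \<union> (X closure_of W - N) else X closure_of P i"
    let ?B = "\<lambda>i. if i = m then topspace X - W else X closure_of Q i"
    have PQcl: "P i \<subseteq> X closure_of P i" "Q i \<subseteq> X closure_of Q i" if "i \<in> I" for i
      using PQ[OF that] by (auto simp: closure_of_subset openin_subset)
    have ABcl: "A i \<subseteq> X closure_of P i" "B i \<subseteq> X closure_of Q i" if "i \<in> I" for i
      using 1(2) PQ[OF that] PQcl[OF that] that by blast+
    show "\<exists>A' B'. closed_disjoint_pairs (insert m I) X A' B' \<and>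
       (\<forall>i\<in>insert m I. A i \<subseteq> A' i \<and> B i \<subseteq> B' i) \<and> topspace X \<subseteq> (\<Union>i\<in>insert m I. A' i \<union> B' i)"
    proof (intro exI conjI)
      show "closed_disjoint_pairs (insert m I) X ?A ?B"
        unfolding closed_disjoint_pairs_def
      proof
        fix i assume "i \<in> insert m I"
        show "closedin X (?A i) \<and> closedin X (?B i) \<and> ?A i \<inter> ?B i = {}"
        proof (cases "i = m")
          case True
          then show ?thesis using Am N W AW clW by (auto intro!: closedin_Un closedin_diff)
        next
          case False
          then show ?thesis using clPQ \<open>i \<in> insert m I\<close> by (auto simp: closed_disjoint_pairs_def)
        qed
      qed
      show "\<forall>i\<in>insert m I. A i \<subseteq> ?A i \<and> B i \<subseteq> ?B i"
        using BW ABcl by auto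
      show "topspace X \<subseteq> (\<Union>i\<in>insert m I. ?A i \<union> ?B i)"
      proof
        fix p assume p: "p \<in> topspace X"
        consider "p \<notin> W" | "p \<in> W" "p \<notin> N" | "p \<in> N" by blast
        then show "p \<in> (\<Union>i\<in>insert m I. ?A i \<union> ?B i)"
        proof cases
          case 1
          then show ?thesis using p by auto
        next
          case 2
          then have "p \<in> X closure_of W - N" using W by (meson DiffI closure_of_subset openin_subset subsetD)
          then show ?thesis by auto
        next
          case 3
          then obtain i where i: "i \<in> I" "p \<in> P i \<union> Q i" by (auto simp: N_def)
          then have "i \<noteq> m" "p \<in> X closure_of P i \<union> X closure_of Q i" using insert.hyps PQcl by auto
          then show ?thesis using i(1) by (intro UN_I[of i]) auto
        qed
      qed
    qed
  qed
qed

section \<open>Brouwer's theorem and independent derivatives\<close>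

text \<open>
  The component of \<open>b\<close> orthogonal to the span of the other vectors is nonzero; normalise it.
\<close>

lemma independent_dual_vectors:
  fixes B :: "'a::euclidean_space set"
  assumes "independent B"
  obtains w where "\<And>b c. b \<in> B \<Longrightarrow> c \<in> B \<Longrightarrow> c \<bullet> w b = (if c = b then 1 else 0)"
proof -
  have "\<exists>w. b \<bullet> w = 1 \<and> (\<forall>c\<in>B - {b}. c \<bullet> w = 0)" if b: "b \<in> B" for b
  proof -
    obtain y z where y: "y \<in> span (B - {b})" and z: "\<And>v. v \<in> span (B - {b}) \<Longrightarrow> orthogonal z v" and yz: "b = y + z"
      using orthogonal_subspace_decomp_exists[of "B - {b}" b] by metis
    have "b \<notin> span (B - {b})" using assms b by (auto simp: dependent_def)
    then have "z \<noteq> 0" using y yz by auto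
    moreover have "b \<bullet> z = z \<bullet> z" using z[OF y] unfolding yz by (simp add: orthogonal_def inner_left_distrib inner_right_distrib inner_commute)
    moreover have "c \<bullet> z = 0" if "c \<in> B - {b}" for c
      using z[OF span_base[OF that]] by (simp add: orthogonal_def inner_commute)
    ultimately show ?thesis by (intro exI[of _ "z /\<^sub>R (z \<bullet> z)"]) auto
  qed
  then obtain w where "\<And>b. b \<in> B \<Longrightarrow> b \<bullet> w b = 1 \<and> (\<forall>c\<in>B - {b}. c \<bullet> w b = 0)" by metis
  then show ?thesis by (intro that[of w]) auto
qed

text \<open>
  For vectors \<open>w b\<close> dual to \<open>B\<close> this is \<open>{x + (\<Sum>b\<in>B. t b *\<^sub>R w b) | t. \<forall>b\<in>B. \<bar>t b\<bar> \<le> r}\<close>. Since the coordinate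
  \<open>t b\<close> of \<open>y\<close> is \<open>b \<bullet> (y - x)\<close>, the set can be written with closed conditions on \<open>y\<close>. The cube has dimension
  \<open>card B\<close>, which may be smaller than that of the ambient space.
\<close>

definition dual_cube :: "'a::euclidean_space set \<Rightarrow> ('a \<Rightarrow> 'a) \<Rightarrow> 'a \<Rightarrow> real \<Rightarrow> 'a set" where
  "dual_cube B w x r = {y. y - x = (\<Sum>b\<in>B. (b \<bullet> (y - x)) *\<^sub>R w b) \<and> (\<forall>b\<in>B. \<bar>b \<bullet> (y - x)\<bar> \<le> r)}"

lemma norm_diff_le_dual_cube:
  assumes "y \<in> dual_cube B w x r"
  shows "norm (y - x) \<le> r * (\<Sum>b\<in>B. norm (w b))"
proof -
  have "norm (y - x) = norm (\<Sum>b\<in>B. (b \<bullet> (y - x)) *\<^sub>R w b)"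
    using assms by (simp add: dual_cube_def)
  also have "\<dots> \<le> (\<Sum>b\<in>B. r * norm (w b))"
    using assms by (intro sum_norm_le) (auto simp: dual_cube_def intro: mult_right_mono)
  finally show ?thesis by (simp add: sum_distrib_left)
qed

lemma compact_dual_cube: "compact (dual_cube B w x r)"
proof -
  have "dual_cube B w x r = {y. y - x = (\<Sum>b\<in>B. (b \<bullet> (y - x)) *\<^sub>R w b)} \<inter>
      (\<Inter>b\<in>B. {y. \<bar>b \<bullet> (y - x)\<bar> \<le> r})"
    by (auto simp: dual_cube_def)
  moreover have "closed \<dots>"
    by (intro closed_Int closed_INT ballI closed_Collect_eq closed_Collect_le continuous_intros)
  moreover have "bounded (dual_cube B w x r)"
    by (intro bounded_subset[OF bounded_cball[of x "r * (\<Sum>b\<in>B. norm (w b))"]])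
       (auto simp: dist_norm norm_minus_commute dest: norm_diff_le_dual_cube)
  ultimately show ?thesis by (simp add: compact_eq_bounded_closed)
qed

text \<open>
  Choose functions \<open>\<psi> b\<close> with values in \<open>[-1, 1]\<close> that are \<open>-1\<close> on \<open>N b\<close> and \<open>1\<close> on \<open>P b\<close>. The map that sends
  \<open>y\<close> to the point with coordinates \<open>- r * \<psi> b y\<close> has a fixed point by Brouwer's theorem. If this point were in
  \<open>P b\<close>, its \<open>b\<close>-coordinate would be \<open>-r\<close>, so it would lie on the opposite face and hence in \<open>N b\<close>; and conversely.
\<close>

lemma cube_opposite_faces_linked:
  fixes B :: "'a::euclidean_space set" and w :: "'a \<Rightarrow> 'a" and x :: 'a
  assumes B: "finite B" and w: "\<And>b c. b \<in> B \<Longrightarrow> c \<in> B \<Longrightarrow> c \<bullet> w b = (if c = b then 1 else 0)"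
    and r: "r \<ge> 0"
  defines "Q \<equiv> dual_cube B w x r"
  assumes cl: "\<And>b. b \<in> B \<Longrightarrow> closedin (top_of_set Q) (N b)" "\<And>b. b \<in> B \<Longrightarrow> closedin (top_of_set Q) (P b)"
    and disj: "\<And>b. b \<in> B \<Longrightarrow> N b \<inter> P b = {}"
    and faces: "\<And>b y. b \<in> B \<Longrightarrow> y \<in> Q \<Longrightarrow> b \<bullet> (y - x) = - r \<Longrightarrow> y \<in> N b"
      "\<And>b y. b \<in> B \<Longrightarrow> y \<in> Q \<Longrightarrow> b \<bullet> (y - x) = r \<Longrightarrow> y \<in> P b"
  shows "\<exists>y\<in>Q. \<forall>b\<in>B. y \<notin> N b \<union> P b"
proof -
  have "\<exists>\<psi>::'a \<Rightarrow> real. continuous_on Q \<psi> \<and> (\<forall>y\<in>Q. \<bar>\<psi> y\<bar> \<le> 1) \<and> (\<forall>y\<in>N b. \<psi> y = -1) \<and> (\<forall>y\<in>P b. \<psi> y = 1)"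
    if b: "b \<in> B" for b
  proof -
    obtain \<psi> :: "'a \<Rightarrow> real" where "continuous_on Q \<psi>" "\<And>y. y \<in> Q \<Longrightarrow> \<psi> y \<in> closed_segment (-1) 1"
      "\<And>y. y \<in> N b \<Longrightarrow> \<psi> y = -1" "\<And>y. y \<in> P b \<Longrightarrow> \<psi> y = 1"
      using Urysohn_local[OF cl[OF b] disj[OF b], of "-1::real" 1] by blast
    then show ?thesis by (intro exI[of _ \<psi>]) (auto simp: closed_segment_eq_real_ivl abs_le_iff)
  qed
  then obtain \<psi> :: "'a \<Rightarrow> 'a \<Rightarrow> real" where \<psi>: "\<And>b. b \<in> B \<Longrightarrow> continuous_on Q (\<psi> b)"
    "\<And>b y. b \<in> B \<Longrightarrow> y \<in> Q \<Longrightarrow> \<bar>\<psi> b y\<bar> \<le> 1" "\<And>b y. b \<in> B \<Longrightarrow> y \<in> N b \<Longrightarrow> \<psi> b y = -1"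
    "\<And>b y. b \<in> B \<Longrightarrow> y \<in> P b \<Longrightarrow> \<psi> b y = 1"
    by metis
  have dual: "c \<bullet> (\<Sum>b\<in>B. t b *\<^sub>R w b) = t c" if "c \<in> B" for c t
  proof -
    have "c \<bullet> (\<Sum>b\<in>B. t b *\<^sub>R w b) = (\<Sum>b\<in>B. if c = b then t b else 0)"
      unfolding inner_sum_right using that by (intro sum.cong) (auto simp: w)
    then show ?thesis using B that by simp
  qed
  have "compact Q" unfolding Q_def by (rule compact_dual_cube)
  moreover have "convex Q"
    unfolding convex_alt
  proof (intro ballI allI impI)
    fix y z and u :: real assume y: "y \<in> Q" and z: "z \<in> Q" and u: "0 \<le> u \<and> u \<le> 1"
    have eq: "((1 - u) *\<^sub>R y + u *\<^sub>R z) - x = (1 - u) *\<^sub>R (y - x) + u *\<^sub>R (z - x)"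
      by (simp add: algebra_simps)
    have "(1 - u) *\<^sub>R (y - x) + u *\<^sub>R (z - x) = (\<Sum>b\<in>B. (b \<bullet> ((1 - u) *\<^sub>R (y - x) + u *\<^sub>R (z - x))) *\<^sub>R w b)"
    proof -
      have "(1 - u) *\<^sub>R (y - x) + u *\<^sub>R (z - x) =
         (1 - u) *\<^sub>R (\<Sum>b\<in>B. (b \<bullet> (y - x)) *\<^sub>R w b) + u *\<^sub>R (\<Sum>b\<in>B. (b \<bullet> (z - x)) *\<^sub>R w b)"
        using y z by (simp add: Q_def dual_cube_def)
      also have "\<dots> = (\<Sum>b\<in>B. (b \<bullet> ((1 - u) *\<^sub>R (y - x) + u *\<^sub>R (z - x))) *\<^sub>R w b)"
        by (simp add: scaleR_sum_right sum.distrib[symmetric] inner_right_distrib scaleR_left_distrib del: inner_diff_right)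
      finally show ?thesis .
    qed
    moreover have "\<bar>b \<bullet> ((1 - u) *\<^sub>R (y - x) + u *\<^sub>R (z - x))\<bar> \<le> r" if "b \<in> B" for b
    proof -
      have "\<bar>b \<bullet> (y - x)\<bar> \<le> r" "\<bar>b \<bullet> (z - x)\<bar> \<le> r" using y z that by (auto simp: Q_def dual_cube_def)
      then have "(1 - u) * \<bar>b \<bullet> (y - x)\<bar> + u * \<bar>b \<bullet> (z - x)\<bar> \<le> r"
        using u by (intro convex_bound_le) auto
      moreover have "\<bar>(1 - u) * (b \<bullet> (y - x)) + u * (b \<bullet> (z - x))\<bar> \<le> (1 - u) * \<bar>b \<bullet> (y - x)\<bar> + u * \<bar>b \<bullet> (z - x)\<bar>"
        using u abs_triangle_ineq[of "(1 - u) * (b \<bullet> (y - x))" "u * (b \<bullet> (z - x))"] by (simp add: abs_mult)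
      ultimately show ?thesis by (simp add: inner_right_distrib del: inner_diff_right)
    qed
    ultimately show "(1 - u) *\<^sub>R y + u *\<^sub>R z \<in> Q" unfolding Q_def dual_cube_def mem_Collect_eq eq by blast
  qed
  moreover have "x \<in> Q" using r by (auto simp: Q_def dual_cube_def)
  moreover define g where "g y = x + (\<Sum>b\<in>B. (- r * \<psi> b y) *\<^sub>R w b)" for y
  have "continuous_on Q g"
    unfolding g_def by (intro continuous_intros \<psi>(1))
  moreover have gc: "c \<bullet> (g y - x) = - r * \<psi> c y" if "c \<in> B" for c y
    using dual[OF that, of "\<lambda>b. - r * \<psi> b y"] by (simp only: g_def add_diff_cancel_left')
  have "g \<in> Q \<rightarrow> Q"
  proof
    fix y assume y: "y \<in> Q"
    have "g y - x = (\<Sum>b\<in>B. (b \<bullet> (g y - x)) *\<^sub>R w b)" by (simp add: gc) (simp add: g_def)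
    moreover have "\<bar>b \<bullet> (g y - x)\<bar> \<le> r" if "b \<in> B" for b
      using \<psi>(2)[OF that y] r by (simp add: gc that abs_mult mult_left_le)
    ultimately show "g y \<in> Q" by (simp add: Q_def dual_cube_def)
  qed
  ultimately obtain y where y: "y \<in> Q" "g y = y"
    using brouwer[of Q g] by blast
  have "y \<notin> N b \<union> P b" if b: "b \<in> B" for b
  proof
    have t: "b \<bullet> (y - x) = - r * \<psi> b y" using gc[OF b, of y] y by simp
    assume "y \<in> N b \<union> P b"
    then show False
    proof
      assume "y \<in> N b"
      then have "y \<in> P b" using \<psi>(3)[OF b] t y by (intro faces(2)[OF b]) auto
      then show False using \<open>y \<in> N b\<close> disj[OF b] by blast
    next
      assume "y \<in> P b"
      then have "y \<in> N b" using \<psi>(4)[OF b] t y by (intro faces(1)[OF b]) auto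
      then show False using \<open>y \<in> P b\<close> disj[OF b] by blast
    qed
  qed
  then show ?thesis using y by blast
qed

text \<open>
  On a small dual cube the functions \<open>\<phi> b \<circ> f\<close> differ from their linear parts by at most half of
  the size \<open>r\<close> of the cube, so \<open>\<phi> b\<close> takes well separated values on the images of the two faces belonging to \<open>b\<close>.
  Disjoint closed sets containing these images and covering the image of the cube would pull back to a
  configuration that Brouwer's theorem excludes.
\<close>

theorem not_dim_le_if_independent_derivatives:
  fixes f :: "'a::euclidean_space \<Rightarrow> 'b" and B :: "'a set" and \<phi> :: "'a \<Rightarrow> 'b \<Rightarrow> real"
  assumes Y: "Hausdorff_space Y" and \<Omega>: "open \<Omega>" "x \<in> \<Omega>"
    and f: "continuous_map (top_of_set \<Omega>) Y f"
    and B: "independent B"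
    and \<phi>: "\<And>b. b \<in> B \<Longrightarrow> continuous_map Y euclideanreal (\<phi> b)"
    and deriv: "\<And>b. b \<in> B \<Longrightarrow> ((\<lambda>y. \<phi> b (f y)) has_derivative (\<lambda>v. b \<bullet> v)) (at x)"
  shows "\<not> Y dim_le (int (card B) - 1)"
proof
  assume dim: "Y dim_le (int (card B) - 1)"
  have fin: "finite B" using B independent_imp_finite by blast
  obtain w where w: "\<And>b c. b \<in> B \<Longrightarrow> c \<in> B \<Longrightarrow> c \<bullet> w b = (if c = b then 1 else 0)"
    using independent_dual_vectors[OF B] by metis
  define W where "W = (\<Sum>b\<in>B. norm (w b)) + 1"
  have "0 \<le> (\<Sum>b\<in>B. norm (w b))" by (rule sum_nonneg) simp
  then have W: "W > 0" by (simp add: W_def)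
  have "\<exists>\<delta>>0. \<forall>y. norm (y - x) < \<delta> \<longrightarrow> \<bar>\<phi> b (f y) - \<phi> b (f x) - b \<bullet> (y - x)\<bar> \<le> 1 / (2 * W) * norm (y - x)"
    if "b \<in> B" for b
  proof -
    have "1 / (2 * W) > 0" using W by simp
    then show ?thesis using deriv[OF that] unfolding has_derivative_at_alt real_norm_def by blast
  qed
  then obtain d where d: "\<And>b. b \<in> B \<Longrightarrow> d b > 0" and dB: "\<And>b y. b \<in> B \<Longrightarrow> norm (y - x) < d b \<Longrightarrow>
      \<bar>\<phi> b (f y) - \<phi> b (f x) - b \<bullet> (y - x)\<bar> \<le> 1 / (2 * W) * norm (y - x)"
    by metis
  obtain \<rho> where \<rho>: "\<rho> > 0" "ball x \<rho> \<subseteq> \<Omega>" using \<Omega> by (meson open_contains_ball)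
  define \<delta> where "\<delta> = Min (insert \<rho> (d ` B))"
  have \<delta>: "\<delta> > 0" "\<delta> \<le> \<rho>" "\<And>b. b \<in> B \<Longrightarrow> \<delta> \<le> d b" using fin d \<rho> by (auto simp: \<delta>_def)
  define r where "r = \<delta> / (2 * W)"
  have r: "r > 0" "r * W < \<delta>" using \<delta> W by (auto simp: r_def)
  define Q where "Q = dual_cube B w x r"
  have Qn: "norm (y - x) \<le> r * W" if "y \<in> Q" for y
  proof -
    have "norm (y - x) \<le> r * (\<Sum>b\<in>B. norm (w b))"
      using that unfolding Q_def by (rule norm_diff_le_dual_cube)
    also have "\<dots> \<le> r * W" using r by (simp add: W_def)
    finally show ?thesis .
  qed
  have Q\<Omega>: "Q \<subseteq> \<Omega>" using Qn r \<delta> \<rho> by (force simp: dist_norm norm_minus_commute)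
  have close: "\<bar>\<phi> b (f y) - \<phi> b (f x) - b \<bullet> (y - x)\<bar> \<le> r / 2" if "b \<in> B" "y \<in> Q" for b y
  proof -
    have "\<bar>\<phi> b (f y) - \<phi> b (f x) - b \<bullet> (y - x)\<bar> \<le> 1 / (2 * W) * norm (y - x)"
      using Qn[OF that(2)] r \<delta>(3)[OF that(1)] by (intro dB that) linarith
    also have "\<dots> \<le> 1 / (2 * W) * (r * W)" using Qn[OF that(2)] W by (intro mult_left_mono) auto
    also have "\<dots> = r / 2" using W by simp
    finally show ?thesis .
  qed
  have Qc: "compact Q" unfolding Q_def by (rule compact_dual_cube)
  let ?K = "subtopology Y (f ` Q)"
  have fQ: "continuous_map (top_of_set Q) Y f"
    using continuous_map_from_subtopology_mono[OF f Q\<Omega>] .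
  have fQK: "continuous_map (top_of_set Q) ?K f"
    using fQ by (simp add: continuous_map_in_subtopology)
  have comp: "compactin Y (f ` Q)"
    by (rule image_compactin[OF _ fQ]) (use Qc in \<open>simp add: compactin_subtopology\<close>)
  have top: "topspace ?K = f ` Q" using compactin_subset_topspace[OF comp] by auto
  have "enlargeable_over B ?K (topspace ?K)"
    using fin comp Y dim by (intro dim_le_imp_enlargeable_over)
      (auto simp: compact_space_subtopology Hausdorff_space_subtopology dimension_le_subtopology)
  moreover define N where "N b = {p \<in> topspace ?K. \<phi> b p \<in> {..\<phi> b (f x) - r / 2}}" for b
  moreover define P where "P b = {p \<in> topspace ?K. \<phi> b p \<in> {\<phi> b (f x) + r / 2..}}" for b
  have "closed_disjoint_pairs B ?K N P"
    unfolding closed_disjoint_pairs_def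
  proof (intro ballI conjI)
    fix b assume b: "b \<in> B"
    have c: "continuous_map ?K euclideanreal (\<phi> b)" by (rule continuous_map_from_subtopology[OF \<phi>[OF b]])
    show "closedin ?K (N b)" "closedin ?K (P b)"
      unfolding N_def P_def by (rule closedin_continuous_map_preimage[OF c], simp)+
    show "N b \<inter> P b = {}" using r by (auto simp: N_def P_def)
  qed
  ultimately obtain N' P' where NP: "closed_disjoint_pairs B ?K N' P'" "\<forall>b\<in>B. N b \<subseteq> N' b \<and> P b \<subseteq> P' b"
    "topspace ?K \<subseteq> (\<Union>b\<in>B. N' b \<union> P' b)"
    by (elim enlargeable_overE)
  have "\<exists>y\<in>Q. \<forall>b\<in>B. y \<notin> {y \<in> topspace (top_of_set Q). f y \<in> N' b} \<union> {y \<in> topspace (top_of_set Q). f y \<in> P' b}"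
    unfolding Q_def
  proof (rule cube_opposite_faces_linked[OF fin w], unfold Q_def[symmetric])
    fix b assume b: "b \<in> B"
    show "closedin (top_of_set Q) {y \<in> topspace (top_of_set Q). f y \<in> N' b}"
      "closedin (top_of_set Q) {y \<in> topspace (top_of_set Q). f y \<in> P' b}"
      using NP(1) b unfolding closed_disjoint_pairs_def
      by (intro closedin_continuous_map_preimage[OF fQK]; blast)+
    show "{y \<in> topspace (top_of_set Q). f y \<in> N' b} \<inter> {y \<in> topspace (top_of_set Q). f y \<in> P' b} = {}"
      using NP(1) b unfolding closed_disjoint_pairs_def by blast
    fix y assume y: "y \<in> Q"
    show "y \<in> {y \<in> topspace (top_of_set Q). f y \<in> N' b}" if "b \<bullet> (y - x) = - r"
    proof -
      have "\<phi> b (f y) \<le> \<phi> b (f x) - r / 2" using close[OF b y] that by linarith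
      then have "f y \<in> N b" using y by (simp add: N_def top del: topspace_subtopology)
      then show ?thesis using NP(2) b y by auto
    qed
    show "y \<in> {y \<in> topspace (top_of_set Q). f y \<in> P' b}" if "b \<bullet> (y - x) = r"
    proof -
      have "\<phi> b (f y) \<ge> \<phi> b (f x) + r / 2" using close[OF b y] that by linarith
      then have "f y \<in> P b" using y by (simp add: P_def top del: topspace_subtopology)
      then show ?thesis using NP(2) b y by auto
    qed
  qed (use r in auto)
  then obtain y where "y \<in> Q" "\<forall>b\<in>B. f y \<notin> N' b \<union> P' b" by auto
  then show False using NP(3) top by blast
qed

section \<open>The rank of the metric derivative\<close>

lemma mcshane_extension:
  fixes g :: "'a::metric_space \<Rightarrow> real"
  assumes g: "L-lipschitz_on S g" and S: "S \<noteq> {}"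
  obtains G where "L-lipschitz_on UNIV G" "\<And>x. x \<in> S \<Longrightarrow> G x = g x"
proof -
  have L: "L \<ge> 0" using g lipschitz_on_nonneg by blast
  define G where "G x = (INF y\<in>S. g y + L * dist x y)" for x
  have lip: "\<bar>g y - g z\<bar> \<le> L * dist y z" if "y \<in> S" "z \<in> S" for y z
    using lipschitz_onD[OF g that] by (simp add: dist_real_def)
  have bdd: "bdd_below ((\<lambda>y. g y + L * dist x y) ` S)" for x
  proof -
    obtain a where a: "a \<in> S" using S by blast
    show ?thesis
    proof (rule bdd_belowI2[where m = "g a - L * dist x a"])
      fix y assume "y \<in> S"
      have "L * dist a y \<le> L * dist x a + L * dist x y"
        using L mult_left_mono[OF dist_triangle3[of a y x]] by (simp add: distrib_left)
      then show "g a - L * dist x a \<le> g y + L * dist x y"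
        using lip[OF a \<open>y \<in> S\<close>] by linarith
    qed
  qed
  have "G x \<le> G x' + L * dist x x'" for x x'
  proof -
    have "G x - L * dist x x' \<le> g y + L * dist x' y" if "y \<in> S" for y
    proof -
      have "G x \<le> g y + L * dist x y" unfolding G_def by (rule cINF_lower[OF bdd that])
      also have "\<dots> \<le> g y + (L * dist x x' + L * dist x' y)"
        using L mult_left_mono[OF dist_triangle[of x y x']] by (simp add: distrib_left)
      finally show ?thesis by simp
    qed
    then have "G x - L * dist x x' \<le> G x'" unfolding G_def[of x'] by (rule cINF_greatest[OF S])
    then show ?thesis by simp
  qed
  then have "\<bar>G x - G x'\<bar> \<le> L * dist x x'" for x x'
    by (smt (verit, best) dist_commute)
  then have "L-lipschitz_on UNIV G" by (intro lipschitz_onI L) (simp add: dist_real_def)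
  moreover have "G x = g x" if "x \<in> S" for x
  proof (rule antisym)
    show "G x \<le> g x" using cINF_lower[OF bdd that, of x] by (simp add: G_def)
    show "g x \<le> G x" unfolding G_def
      by (rule cINF_greatest[OF S]) (use lip[OF that] in \<open>force simp: abs_le_iff\<close>)
  qed
  ultimately show ?thesis using that by blast
qed

lemma seminorm_rank_eq_dim_gradients:
  fixes \<sigma> :: "'a::euclidean_space \<Rightarrow> real"
  assumes "\<And>v. \<sigma> v = 0 \<longleftrightarrow> (\<forall>i. g i \<bullet> v = 0)"
  shows "seminorm_rank \<sigma> = dim (range g)"
proof -
  have "{v. \<sigma> v = 0} = {v \<in> UNIV. \<forall>w \<in> span (range g). orthogonal w v}"
  proof (intro Collect_cong)
    fix v
    have "\<sigma> v = 0 \<longleftrightarrow> (\<forall>w\<in>range g. orthogonal v w)"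
      using assms by (auto simp: orthogonal_def inner_commute)
    also have "\<dots> \<longleftrightarrow> (\<forall>w\<in>span (range g). orthogonal v w)"
      using orthogonal_to_span[of _ "range g" v] span_base by blast
    finally show "\<sigma> v = 0 \<longleftrightarrow> v \<in> UNIV \<and> (\<forall>w \<in> span (range g). orthogonal w v)"
      by (simp add: orthogonal_commute)
  qed
  moreover have "dim {v \<in> UNIV. \<forall>w \<in> span (range g). orthogonal w v} + dim (span (range g)) = dim (UNIV :: 'a set)"
    by (rule dim_subspace_orthogonal_to_vectors) auto
  ultimately show ?thesis by (simp add: seminorm_rank_def)
qed

lemma has_metric_derivative_derivative_sup:
  fixes F :: "nat \<Rightarrow> 'a::euclidean_space \<Rightarrow> real" and X :: "'b metric"
  assumes lip: "\<And>i. L-lipschitz_on UNIV (F i)" and diff: "\<And>i. F i differentiable (at x)" and x: "x \<in> \<Omega>"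
    and F_le: "\<And>i y. y \<in> \<Omega> \<Longrightarrow> \<bar>F i y - F i x\<bar> \<le> mdist X (f y) (f x)"
    and F_ge: "\<And>y e. y \<in> \<Omega> \<Longrightarrow> e > 0 \<Longrightarrow> \<exists>i. mdist X (f y) (f x) \<le> \<bar>F i y - F i x\<bar> + e"
    and up: "\<And>\<epsilon>. \<epsilon> > 0 \<Longrightarrow> \<exists>\<delta>>0. \<forall>y. norm y < \<delta> \<longrightarrow>
        (\<forall>i. \<bar>F i (x + y) - F i x\<bar> \<le> derivative_sup F x y + \<epsilon> * norm y)"
  shows "has_metric_derivative X \<Omega> f x (derivative_sup F x)"
  unfolding has_metric_derivative_def
proof
  show "seminorm (derivative_sup F x)" by (rule seminorm_derivative_sup[of L F, OF lip diff])
  show "((\<lambda>y. (mdist X (f y) (f x) - derivative_sup F x (y - x)) / norm (y - x)) \<longlongrightarrow> 0) (at x within \<Omega>)"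
    unfolding Lim_within
  proof (intro allI impI)
    fix e :: real assume "e > 0"
    then have e: "e / 2 > 0" by simp
    obtain \<delta>1 where \<delta>1: "\<delta>1 > 0" "\<And>y i. norm y < \<delta>1 \<Longrightarrow>
        \<bar>F i (x + y) - F i x\<bar> \<le> derivative_sup F x y + e / 2 * norm y"
      using up[OF e] by blast
    obtain \<delta>2 where \<delta>2: "\<delta>2 > 0" "\<And>y. norm y < \<delta>2 \<Longrightarrow>
        \<exists>i. derivative_sup F x y \<le> \<bar>F i (x + y) - F i x\<bar> + e / 2 * norm y"
      by (rule some_increment_ge_derivative_sup[of L F, OF lip diff e]) blast
    show "\<exists>d>0. \<forall>y\<in>\<Omega>. 0 < dist y x \<and> dist y x < d \<longrightarrow>
        dist ((mdist X (f y) (f x) - derivative_sup F x (y - x)) / norm (y - x)) 0 < e"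
    proof (intro exI conjI ballI impI)
      show "min \<delta>1 \<delta>2 > 0" using \<delta>1 \<delta>2 by simp
      fix y assume y: "y \<in> \<Omega>" "0 < dist y x \<and> dist y x < min \<delta>1 \<delta>2"
      then have n: "norm (y - x) > 0" "norm (y - x) < \<delta>1" "norm (y - x) < \<delta>2" by (auto simp: dist_norm)
      let ?m = "mdist X (f y) (f x)" and ?s = "derivative_sup F x (y - x)"
      have "?m \<le> ?s + e / 2 * norm (y - x)"
      proof (rule field_le_epsilon)
        fix \<eta> :: real assume "\<eta> > 0"
        then obtain i where "?m \<le> \<bar>F i y - F i x\<bar> + \<eta>" using F_ge[OF y(1)] by blast
        moreover have "\<bar>F i y - F i x\<bar> \<le> ?s + e / 2 * norm (y - x)" using \<delta>1(2)[OF n(2), of i] by simp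
        ultimately show "?m \<le> ?s + e / 2 * norm (y - x) + \<eta>" by linarith
      qed
      moreover have "?s \<le> ?m + e / 2 * norm (y - x)"
      proof -
        obtain i where "?s \<le> \<bar>F i y - F i x\<bar> + e / 2 * norm (y - x)" using \<delta>2(2)[OF n(3)] by auto
        then show ?thesis using F_le[OF y(1), of i] by linarith
      qed
      ultimately have "\<bar>?m - ?s\<bar> \<le> e / 2 * norm (y - x)" by linarith
      also have "\<dots> < e * norm (y - x)" using n \<open>e > 0\<close> by simp
      finally show "dist ((?m - ?s) / norm (y - x)) 0 < e"
        using n by (simp add: dist_real_def field_simps)
    qed
  qed
qed

text \<open>
  The rank is the number of independent gradients among those of the \<open>F i\<close>. If there were \<open>j + 1\<close> of them, they
  would contradict \<open>not_dim_le_if_independent_derivatives\<close>.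
\<close>

lemma seminorm_rank_derivative_sup_le:
  fixes F :: "nat \<Rightarrow> 'a::euclidean_space \<Rightarrow> real" and f :: "'a \<Rightarrow> 'b"
  assumes lip: "\<And>i. L-lipschitz_on UNIV (F i)" and diff: "\<And>i. F i differentiable (at x)"
    and \<Omega>: "open \<Omega>" "x \<in> \<Omega>" and Y: "Hausdorff_space Y" "Y dim_le j"
    and f: "continuous_map (top_of_set \<Omega>) Y f"
    and \<phi>: "\<And>i. continuous_map Y euclideanreal (\<phi> i)"
    and F: "\<And>i y. y \<in> \<Omega> \<Longrightarrow> F i y = \<phi> i (f y)"
  shows "int (seminorm_rank (derivative_sup F x)) \<le> j"
proof (rule ccontr)
  assume contra: "\<not> int (seminorm_rank (derivative_sup F x)) \<le> j"
  let ?D = "\<lambda>i. frechet_derivative (F i) (at x)"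
  have lin: "linear (?D i)" for i by (rule linear_frechet_derivative[OF diff])
  define g where "g i = (\<Sum>b\<in>Basis. ?D i b *\<^sub>R b)" for i
  have g: "?D i v = g i \<bullet> v" for i v
  proof -
    have "?D i v = ?D i (\<Sum>b\<in>Basis. (v \<bullet> b) *\<^sub>R b)" by (simp add: euclidean_representation)
    also have "\<dots> = (\<Sum>b\<in>Basis. (v \<bullet> b) * ?D i b)"
      by (simp add: linear_sum[OF lin] linear_cmul[OF lin])
    also have "\<dots> = g i \<bullet> v"
      unfolding g_def inner_sum_left by (intro sum.cong) (simp_all add: inner_commute[of v])
    finally show ?thesis .
  qed
  have "derivative_sup F x v = 0 \<longleftrightarrow> (\<forall>i. g i \<bullet> v = 0)" for v
  proof
    assume "derivative_sup F x v = 0"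
    then have "\<bar>?D i v\<bar> \<le> 0" for i
      using frechet_derivative_le_derivative_sup[of L F x i v, OF lip diff] by simp
    then show "\<forall>i. g i \<bullet> v = 0" by (simp add: g)
  next
    assume "\<forall>i. g i \<bullet> v = 0"
    then show "derivative_sup F x v = 0" by (simp add: derivative_sup_def g)
  qed
  then have "seminorm_rank (derivative_sup F x) = dim (range g)"
    by (rule seminorm_rank_eq_dim_gradients)
  then have rank: "j < int (dim (range g))" using contra by simp
  obtain C where C: "C \<subseteq> range g" "independent C" "card C = dim (range g)"
    using basis_exists[of "range g"] by metis
  have j: "-1 \<le> j" by (rule dimension_le_bound[OF Y(2)])
  have "nat (j + 1) \<le> card C" using rank C by simp
  then obtain B where B: "B \<subseteq> C" "card B = nat (j + 1)" by (meson obtain_subset_with_card_n)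
  have "\<forall>b\<in>B. \<exists>i. g i = b" using B C by blast
  then obtain I where I: "\<And>b. b \<in> B \<Longrightarrow> g (I b) = b" by metis
  have "((\<lambda>y. \<phi> (I b) (f y)) has_derivative (\<lambda>v. b \<bullet> v)) (at x)" if b: "b \<in> B" for b
  proof (rule has_derivative_transform_within_open[OF _ \<Omega>])
    have "?D (I b) = (\<lambda>v. b \<bullet> v)" using g[of "I b"] I[OF b] by auto
    then show "(F (I b) has_derivative (\<lambda>v. b \<bullet> v)) (at x)"
      using diff[of "I b"] frechet_derivative_works by metis
  qed (use F in auto)
  then have "\<not> Y dim_le (int (card B) - 1)"
    using independent_mono[OF C(2) B(1)] \<phi> by (intro not_dim_le_if_independent_derivatives[OF Y(1) \<Omega> f]) auto
  then show False using Y(2) B(2) j by simp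
qed

theorem theorem1p8:
  fixes \<Omega> :: "(real ^ 'n) set"
    and X :: "'b metric"
    and f :: "real ^ 'n \<Rightarrow> 'b"
    and k :: ereal
  assumes "open \<Omega>"
    and "Lipschitz_continuous_map (submetric euclidean_metric \<Omega>) X f"
    and "has_small_inductive_dim (mtopology_of X) k"
  shows "AE x in lebesgue_on \<Omega>.
           metrically_differentiable X \<Omega> f x \<and>
           ereal (real (seminorm_rank (md X \<Omega> f x))) \<le> k"
proof (cases "\<Omega> = {}")
  case True
  then show ?thesis by (simp add: AE_restrict_space_iff)
next
  case False
  obtain L where L: "L > 0" and f: "\<And>x. x \<in> \<Omega> \<Longrightarrow> f x \<in> mspace X"
    and fL: "\<And>x y. x \<in> \<Omega> \<Longrightarrow> y \<in> \<Omega> \<Longrightarrow> mdist X (f x) (f y) \<le> L * dist x y"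
    using assms(2) unfolding Lipschitz_continuous_map_pos by (auto simp: Pi_iff)
  have cont: "continuous_map (top_of_set \<Omega>) (mtopology_of X) f"
    using Lipschitz_continuous_imp_continuous_map[OF assms(2)] by (simp add: mtopology_of_submetric)
  obtain T where T: "countable T" "T \<subseteq> \<Omega>" "\<Omega> \<subseteq> closure T" by (rule separable)
  have "T \<noteq> {}" using T False by auto
  define z where "z = from_nat_into T"
  have z: "range z = T" using T(1) \<open>T \<noteq> {}\<close> by (simp add: z_def range_from_nat_into)
  then have z\<Omega>: "z i \<in> \<Omega>" for i using T(2) by blast
  define \<phi> where "\<phi> i p = mdist X p (f (z i))" for i p
  have lip\<phi>: "\<bar>\<phi> i (f x) - \<phi> i (f y)\<bar> \<le> mdist X (f x) (f y)" if "x \<in> \<Omega>" "y \<in> \<Omega>" for i x y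
    using mdist_triangle[of "f x" X "f y" "f (z i)"] mdist_triangle[of "f y" X "f x" "f (z i)"] f that z\<Omega>[of i]
    by (simp add: \<phi>_def abs_le_iff mdist_commute)
  have "L-lipschitz_on \<Omega> (\<lambda>x. \<phi> i (f x))" for i
  proof (rule lipschitz_onI)
    fix x y assume "x \<in> \<Omega>" "y \<in> \<Omega>"
    then show "dist (\<phi> i (f x)) (\<phi> i (f y)) \<le> L * dist x y"
      using lip\<phi>[of x y i] fL[of x y] by (simp add: dist_real_def)
  qed (use L in simp)
  then have "\<exists>G. L-lipschitz_on UNIV G \<and> (\<forall>x\<in>\<Omega>. G x = \<phi> i (f x))" for i
    by (metis mcshane_extension False)
  then obtain F where lip: "\<And>i. L-lipschitz_on UNIV (F i)" and F: "\<And>i x. x \<in> \<Omega> \<Longrightarrow> F i x = \<phi> i (f x)"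
    by metis
  have F_ge: "\<exists>i. mdist X (f y) (f x) \<le> \<bar>F i y - F i x\<bar> + e" if xy: "x \<in> \<Omega>" "y \<in> \<Omega>" and e: "e > 0" for x y e
  proof -
    have "x \<in> closure T" using T xy by blast
    then obtain i where i: "dist (z i) x < e / (2 * L)"
      using L e z unfolding closure_approachable by (metis divide_pos_pos imageE mult_pos_pos zero_less_numeral)
    have "mdist X (f x) (f (z i)) \<le> L * dist x (z i)" by (rule fL[OF xy(1) z\<Omega>])
    also have "\<dots> \<le> L * (e / (2 * L))" using i L by (intro mult_left_mono) (auto simp: dist_commute)
    also have "\<dots> = e / 2" using L by simp
    finally have "mdist X (f x) (f (z i)) \<le> e / 2" .
    moreover have "mdist X (f y) (f x) \<le> mdist X (f y) (f (z i)) + mdist X (f x) (f (z i))"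
      using mdist_triangle[of "f y" X "f (z i)" "f x"] f xy z\<Omega>[of i] by (simp add: mdist_commute)
    ultimately have "mdist X (f y) (f x) \<le> \<bar>F i y - F i x\<bar> + e" using xy by (simp add: F \<phi>_def)
    then show ?thesis ..
  qed
  have \<phi>_cont: "continuous_map (mtopology_of X) euclideanreal (\<phi> i)" for i
    unfolding \<phi>_def
    by (intro continuous_map_mdist) (use f z\<Omega> in \<open>auto simp: continuous_map_const id_def[symmetric]\<close>)
  have haus: "Hausdorff_space (mtopology_of X)"
    unfolding mtopology_of_def by (intro Metric_space.Hausdorff_space_mtopology Metric_space_mspace_mdist)
  have "\<Omega> \<inter> space lebesgue \<in> sets lebesgue" using assms(1) by simp
  moreover have "AE x in lebesgue. x \<in> \<Omega> \<longrightarrow> metrically_differentiable X \<Omega> f x \<and>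
           ereal (real (seminorm_rank (md X \<Omega> f x))) \<le> k"
    using AE_increments_le_derivative_sup[of L F, OF lip]
  proof eventually_elim
    fix x assume x: "(\<forall>i. F i differentiable (at x)) \<and>
    (\<forall>\<epsilon>>0. \<exists>\<delta>>0. \<forall>y. norm y < \<delta> \<longrightarrow> (\<forall>i. \<bar>F i (x + y) - F i x\<bar> \<le> derivative_sup F x y + \<epsilon> * norm y))"
    show "x \<in> \<Omega> \<longrightarrow> metrically_differentiable X \<Omega> f x \<and> ereal (real (seminorm_rank (md X \<Omega> f x))) \<le> k"
    proof
      assume x\<Omega>: "x \<in> \<Omega>"
      have F_le: "\<bar>F i y - F i x\<bar> \<le> mdist X (f y) (f x)" if "y \<in> \<Omega>" for i y
        using lip\<phi>[OF that x\<Omega>] that x\<Omega> by (simp add: F)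
      have md: "has_metric_derivative X \<Omega> f x (derivative_sup F x)"
        by (rule has_metric_derivative_derivative_sup[of L F, OF lip])
           (use x x\<Omega> F_le F_ge in auto)
      have "ereal (real (seminorm_rank (derivative_sup F x))) \<le> k"
      proof (cases "k = \<infinity>")
        case False
        then obtain j where j: "k = ereal (real_of_int j)" "mtopology_of X dim_le j"
          using assms(3) unfolding has_small_inductive_dim_def by blast
        have "int (seminorm_rank (derivative_sup F x)) \<le> j"
          by (rule seminorm_rank_derivative_sup_le[of L F, OF lip _ assms(1) x\<Omega> haus j(2) cont \<phi>_cont F]) (use x in auto)
        then show ?thesis unfolding j(1) by simp
      qed simp
      then show "metrically_differentiable X \<Omega> f x \<and> ereal (real (seminorm_rank (md X \<Omega> f x))) \<le> k"
        using md md_eq[OF assms(1) x\<Omega> md] unfolding metrically_differentiable_def by auto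
    qed
  qed
  ultimately show ?thesis by (subst AE_restrict_space_iff)
qed

end
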